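(* Consider the data model $y_i=\theta_{0,i}+\epsilon_i$, $i=1,\ldots,n$, where $\epsilon_1,\ldots,\epsilon_n$ are i.i.d. sub-Gaussian errors, i.e., $\mathbb{E}(\epsilon_i)=0$ and $\mathbb{P}(|\epsilon_i|>u)\le M\exp(-u^2/(2\sigma^2))$ for all $u\ge 0$, for constants $M,\sigma>0$, and where $\theta_0\in\mathrm{BV}_G(t)$ for a generic connected undirected graph $G$ on $V=\{1,\ldots,n\}$. Then for any DFS ordering of $G$, yielding a permutation matrix $P$, the DFS fused lasso estimator $$\hat\theta_{\mathrm{DFS}}=\operatorname*{argmin}_{\theta\in\mathbb{R}^n}\ \tfrac12\|y-\theta\|_2^2+\lambda\|\nabla_{\mathrm{1d}}P\theta\|_1,$$ with a choice of tuning parameter $\lambda\asymp t^{-1/3}n^{1/3}$, has mean squared error converging in probability at the rate $$\|\hat\theta_{\mathrm{DFS}}-\theta_0\|_n^2=O_{\mathbb{P}}(t^{2/3}n^{-2/3}).$$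
   Context: For a graph $G=(V,E)$ with each edge $e$ arbitrarily oriented with endpoints $e^+,e^-$, $\|\nabla_G\theta\|_1=\sum_{e\in E}|\theta_{e^+}-\theta_{e^-}|$, and for a radius $t>0$, $\mathrm{BV}_G(t)=\{\theta\in\mathbb{R}^n:\|\nabla_G\theta\|_1\le t\}$. $\nabla_{\mathrm{1d}}\in\mathbb{R}^{(n-1)\times n}$ is the first difference matrix, $(\nabla_{\mathrm{1d}}x)_i=x_{i+1}-x_i$. A DFS ordering is the list $v_1,\ldots,v_n$ of nodes in the order in which they are reached by a run of depth-first search on $G$, and the associated permutation matrix $P$ is defined by $(P\theta)_i=\theta_{v_i}$. $\|x\|_n^2=\|x\|_2^2/n$. $a_n=O(b_n)$ means $a_n/b_n$ is upper bounded for $n$ large enough; $a_n\asymp b_n$ means both $a_n=O(b_n)$ and $a_n^{-1}=O(b_n^{-1})$; $A_n=O_{\mathbb{P}}(B_n)$ means that $A_n/B_n$ is bounded in probability.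
   Formalization: The radius t may vary with n subject to 1/t = O(√n), automatic for fixed t > 0; for smaller t the claimed rate falls below the parametric rate 1/n and the claim fails (e.g. t = n^{-2}, θ_0 = 0, Gaussian errors, λ = n). *)

theory Defs
  imports "HOL-Probability.Probability" "HOL-Library.Landau_Symbols"
begin

text \<open>Undirected simple graphs: the edges are two-element sets of nodes.\<close>

definition simple_graph :: "'v set \<Rightarrow> 'v set set \<Rightarrow> bool" where
  "simple_graph V E \<longleftrightarrow> finite V \<and> (\<forall>e\<in>E. e \<subseteq> V \<and> card e = 2)"

definition connected_graph :: "'v set \<Rightarrow> 'v set set \<Rightarrow> bool" where
  "connected_graph V E \<longleftrightarrow>
     simple_graph V E \<and> V \<noteq> {} \<and> (\<forall>u\<in>V. \<forall>v\<in>V. (u, v) \<in> {(a, b). {a, b} \<in> E}\<^sup>*)"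

text \<open>
  A state of depth-first search consists of the stack, which is the path from the current node
  back to the root, and the list of the nodes reached so far, in the order in which they were
  reached. The search moves to any unvisited neighbour of the current node if there is one, and
  backtracks otherwise. The root and the neighbour to visit next are chosen freely.
\<close>

inductive dfs_step :: "'v set set \<Rightarrow> 'v list \<times> 'v list \<Rightarrow> 'v list \<times> 'v list \<Rightarrow> bool"
  for E :: "'v set set" where
  visit: "{u, v} \<in> E \<Longrightarrow> v \<notin> set vs \<Longrightarrow> dfs_step E (u # st, vs) (v # u # st, vs @ [v])"
| backtrack: "(\<And>v. {u, v} \<in> E \<Longrightarrow> v \<in> set vs) \<Longrightarrow> dfs_step E (u # st, vs) (st, vs)"

definition dfs_ordering :: "'v set \<Rightarrow> 'v set set \<Rightarrow> 'v list \<Rightarrow> bool" where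
  "dfs_ordering V E vs \<longleftrightarrow> (\<exists>r\<in>V. (dfs_step E)\<^sup>*\<^sup>* ([r], [r]) ([], vs))"

text \<open>
  A vector in the \<open>n\<close>-dimensional real space is a function \<open>nat \<Rightarrow> real\<close> with the indices
  \<open>1, \<dots>, n\<close>; \<open>extensional {1..n}\<close> fixes its values at all other arguments.
\<close>

abbreviation Rn :: "nat \<Rightarrow> (nat \<Rightarrow> real) set" where
  "Rn n \<equiv> extensional {1..n}"

text \<open>Every edge is oriented from its smaller to its larger endpoint; the absolute values make
  the sum independent of the orientation.\<close>

definition graph_tv :: "nat set set \<Rightarrow> (nat \<Rightarrow> real) \<Rightarrow> real" where
  "graph_tv E \<theta> = (\<Sum>e\<in>E. \<bar>\<theta> (Max e) - \<theta> (Min e)\<bar>)"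

definition BV :: "nat \<Rightarrow> nat set set \<Rightarrow> real \<Rightarrow> (nat \<Rightarrow> real) set" where
  "BV n E t = {\<theta> \<in> Rn n. graph_tv E \<theta> \<le> t}"

definition diff_1d :: "(nat \<Rightarrow> real) \<Rightarrow> nat \<Rightarrow> real" where
  "diff_1d x i = x (i + 1) - x i"

text \<open>Coordinates are numbered from 1, list positions from 0.\<close>

definition perm_vec :: "nat list \<Rightarrow> (nat \<Rightarrow> real) \<Rightarrow> nat \<Rightarrow> real" where
  "perm_vec vs \<theta> i = \<theta> (vs ! (i - 1))"

definition fused_lasso_objective ::
    "nat \<Rightarrow> nat list \<Rightarrow> real \<Rightarrow> (nat \<Rightarrow> real) \<Rightarrow> (nat \<Rightarrow> real) \<Rightarrow> real" where
  "fused_lasso_objective n vs lam y \<theta> =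
     1/2 * (\<Sum>i\<in>{1..n}. (y i - \<theta> i)\<^sup>2) + lam * (\<Sum>i\<in>{1..<n}. \<bar>diff_1d (perm_vec vs \<theta>) i\<bar>)"

definition dfs_fused_lasso ::
    "nat \<Rightarrow> nat list \<Rightarrow> real \<Rightarrow> (nat \<Rightarrow> real) \<Rightarrow> nat \<Rightarrow> real" where
  "dfs_fused_lasso n vs lam y = arg_min (fused_lasso_objective n vs lam y) (\<lambda>\<theta>. \<theta> \<in> Rn n)"

definition sq_norm_n :: "nat \<Rightarrow> (nat \<Rightarrow> real) \<Rightarrow> real" where
  "sq_norm_n n x = (\<Sum>i\<in>{1..n}. (x i)\<^sup>2) / real n"

definition sub_gaussian :: "'a measure \<Rightarrow> real \<Rightarrow> real \<Rightarrow> ('a \<Rightarrow> real) \<Rightarrow> bool" where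
  "sub_gaussian \<Omega> M \<sigma> X \<longleftrightarrow>
     integrable \<Omega> X \<and> integral\<^sup>L \<Omega> X = 0 \<and>
     (\<forall>u\<ge>0. measure \<Omega> {\<omega>\<in>space \<Omega>. \<bar>X \<omega>\<bar> > u} \<le> M * exp (- (u\<^sup>2 / (2 * \<sigma>\<^sup>2))))"

definition iid_vars :: "'a measure \<Rightarrow> 'i set \<Rightarrow> ('i \<Rightarrow> 'a \<Rightarrow> real) \<Rightarrow> bool" where
  "iid_vars \<Omega> I X \<longleftrightarrow>
     prob_space.indep_vars \<Omega> (\<lambda>_. borel) X I \<and>
     (\<forall>i\<in>I. \<forall>j\<in>I. distr \<Omega> borel (X i) = distr \<Omega> borel (X j))"

text \<open>
  Boundedness in probability of \<open>X n / b n\<close>, where \<open>X n\<close> lives on the space \<open>\<Omega> n\<close>. The bound is on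
  the probability of the good event because \<open>measure\<close> is 0 on sets that are not measurable:
  an upper bound for the bad event would hold trivially for such sets.
\<close>

definition bigo_prob ::
    "(nat \<Rightarrow> 'a measure) \<Rightarrow> (nat \<Rightarrow> 'a \<Rightarrow> real) \<Rightarrow> (nat \<Rightarrow> real) \<Rightarrow> bool" where
  "bigo_prob \<Omega> X b \<longleftrightarrow>
     (\<forall>\<delta>>0. \<exists>C. \<forall>\<^sub>F n in sequentially.
        measure (\<Omega> n) {\<omega>\<in>space (\<Omega> n). \<bar>X n \<omega>\<bar> \<le> C * \<bar>b n\<bar>} \<ge> 1 - \<delta>)"

definition same_order :: "(nat \<Rightarrow> real) \<Rightarrow> (nat \<Rightarrow> real) \<Rightarrow> bool" where
  "same_order a b \<longleftrightarrow> a \<in> O(b) \<and> (\<lambda>n. inverse (a n)) \<in> O(\<lambda>n. inverse (b n))"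

end

theory Submission
  imports Defs
begin

text \<open>
  A depth-first search walks every tree edge twice, so the total variation along a DFS ordering is at
  most twice the one over the graph, and everything reduces to the fused lasso on a path. With
  \<open>\<delta>\<close> the estimation error, the variational inequality of the estimator bounds \<open>\<parallel>\<delta>\<parallel>\<^sup>2\<close> by
  \<open>\<langle>\<epsilon>, \<delta>\<rangle> + \<lambda> (TV \<theta>\<^sub>0 - TV \<theta>)\<close>, where \<open>\<theta>\<close> is the estimator. The noise is controlled by

  \<open>\<langle>\<epsilon>, v\<rangle> \<le> \<parallel>v\<parallel>\<^sup>2 / 4 + \<lambda> TV v + O\<^sub>P(1 + n / \<lambda>\<^sup>2)\<close>, uniformly in \<open>v\<close>,

  which follows by expanding both vectors in the Haar basis up to blocks of length of order \<open>\<lambda>\<^sup>2\<close>: the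
  Haar coefficients of \<open>v\<close> are dominated by its variation, so that only the part of the coefficients of
  \<open>\<epsilon>\<close> above a level-dependent threshold has to be paid for by \<open>\<parallel>v\<parallel>\<^sup>2\<close>. For the given order of
  \<open>\<lambda>\<close> the terms \<open>\<lambda> t\<close>, \<open>n / \<lambda>\<^sup>2\<close> and \<open>1\<close> are all \<open>O(t\<^bsup>2/3\<^esup> n\<^bsup>1/3\<^esup>)\<close>.
\<close>

section \<open>Total variation along a depth-first search\<close>

fun path_length :: "('v \<Rightarrow> real) \<Rightarrow> 'v list \<Rightarrow> real" where
  "path_length f (u # v # vs) = \<bar>f u - f v\<bar> + path_length f (v # vs)"
| "path_length f _ = 0"

lemma path_length_Cons: "vs \<noteq> [] \<Longrightarrow> path_length f (u # vs) = \<bar>f u - f (hd vs)\<bar> + path_length f vs"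
  by (cases vs) auto

lemma path_length_snoc: "vs \<noteq> [] \<Longrightarrow> path_length f (vs @ [v]) = path_length f vs + \<bar>f (last vs) - f v\<bar>"
  by (induction f vs rule: path_length.induct) auto

lemma path_length_conv_sum:
  "path_length f vs = (\<Sum>i<length vs - 1. \<bar>f (vs ! Suc i) - f (vs ! i)\<bar>)"
proof (induction f vs rule: path_length.induct)
  case (1 f u v vs)
  show ?case using 1 by (simp add: sum.lessThan_Suc_shift abs_minus_commute del: sum.lessThan_Suc)
qed auto

lemma edge_diff:
  fixes \<theta> :: "nat \<Rightarrow> real"
  shows "\<bar>\<theta> (Max {u, v}) - \<theta> (Min {u, v})\<bar> = \<bar>\<theta> u - \<theta> v\<bar>"
  by (cases "u \<le> v") (simp_all add: max_def min_def abs_minus_commute)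

text \<open>Every tree edge is walked twice: the walk so far, extended from the last reached node to the
  current node and from there back to the root, is no longer than twice the tree.\<close>

lemma dfs_path_length_invariant:
  fixes \<theta> :: "nat \<Rightarrow> real"
  assumes "(dfs_step E)\<^sup>*\<^sup>* ([r], [r]) (st, vs)"
  shows "vs \<noteq> [] \<and> set st \<subseteq> set vs \<and>
    (\<exists>T. T \<subseteq> E \<and> finite T \<and> \<Union>T \<subseteq> set vs \<and>
      path_length \<theta> vs + (if st = [] then 0 else \<bar>\<theta> (last vs) - \<theta> (hd st)\<bar>) + path_length \<theta> st
        \<le> 2 * graph_tv T \<theta>)"
  using assms
proof (induction rule: rtranclp_induct2)
  case refl
  show ?case by (auto intro!: exI[of _ "{}"] simp: graph_tv_def)
next
  case (step st vs st' vs')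
  from step.IH obtain T where ne: "vs \<noteq> []" and st: "set st \<subseteq> set vs" and
    T: "T \<subseteq> E" "finite T" "\<Union>T \<subseteq> set vs" and
    le: "path_length \<theta> vs + (if st = [] then 0 else \<bar>\<theta> (last vs) - \<theta> (hd st)\<bar>) + path_length \<theta> st
        \<le> 2 * graph_tv T \<theta>" by auto
  from step.hyps(2) show ?case
  proof cases
    case (visit u v ws)
    \<comment> \<open>\<open>v\<close> is unvisited, while the edges of \<open>T\<close> join
      visited nodes; the invariant confines \<open>T\<close> for this purpose.\<close>
    have new: "{u, v} \<notin> T" using visit T by auto
    have "graph_tv (insert {u, v} T) \<theta> = \<bar>\<theta> u - \<theta> v\<bar> + graph_tv T \<theta>"
      unfolding graph_tv_def using new T(2) by (simp add: edge_diff del: Max_insert Min_insert)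
    \<comment> \<open>The last node \<open>v\<close> is now also the top of the stack, so the detour
      term vanishes. Reaching \<open>v\<close> costs at most the old detour plus the new edge, and
      the longer stack counts that edge once more: together the factor 2.\<close>
    then have "path_length \<theta> vs' + (if st' = [] then 0 else \<bar>\<theta> (last vs') - \<theta> (hd st')\<bar>)
        + path_length \<theta> st' \<le> 2 * graph_tv (insert {u, v} T) \<theta>"
      using le ne visit abs_triangle_ineq[of "\<theta> (last vs) - \<theta> u" "\<theta> u - \<theta> v"]
      by (simp add: path_length_snoc abs_minus_commute)
    moreover have "insert {u, v} T \<subseteq> E" "finite (insert {u, v} T)" "\<Union>(insert {u, v} T) \<subseteq> set vs'"
      using visit T st by auto
    moreover have "vs' \<noteq> []" "set st' \<subseteq> set vs'" using visit st by auto
    ultimately show ?thesis by blast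
  next
    case (backtrack u)
    \<comment> \<open>Popping \<open>u\<close> replaces the way from the last node through
      \<open>u\<close> to its parent by the direct difference, which is no longer by the triangle
      inequality.\<close>
    have "path_length \<theta> vs' + (if st' = [] then 0 else \<bar>\<theta> (last vs') - \<theta> (hd st')\<bar>) + path_length \<theta> st'
        \<le> 2 * graph_tv T \<theta>"
      using le backtrack by (cases "st' = []") (auto simp: path_length_Cons)
    moreover have "vs' = vs" "set st' \<subseteq> set vs'" using st backtrack by auto
    ultimately show ?thesis using ne T by blast
  qed
qed

lemma dfs_ordering_path_length:
  fixes \<theta> :: "nat \<Rightarrow> real"
  assumes "finite E" "dfs_ordering V E vs"
  shows "path_length \<theta> vs \<le> 2 * graph_tv E \<theta>"
proof -
  from assms obtain r where "(dfs_step E)\<^sup>*\<^sup>* ([r], [r]) ([], vs)" by (auto simp: dfs_ordering_def)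
  from dfs_path_length_invariant[OF this, of \<theta>] obtain T where
    T: "T \<subseteq> E" "path_length \<theta> vs \<le> 2 * graph_tv T \<theta>" by auto
  have "graph_tv T \<theta> \<le> graph_tv E \<theta>"
    unfolding graph_tv_def using assms(1) T(1) by (intro sum_mono2) auto
  with T show ?thesis by simp
qed

text \<open>A node leaves the stack only when all its neighbours have been reached. Once the stack
  is empty, the visited set is therefore closed under adjacency, and connectivity makes it all of
  \<open>V\<close>.\<close>

lemma dfs_visited_invariant:
  assumes "(dfs_step E)\<^sup>*\<^sup>* ([r], [r]) (st, vs)"
  shows "distinct vs \<and> r \<in> set vs \<and> (\<forall>u w. u \<in> set vs - set st \<longrightarrow> {u, w} \<in> E \<longrightarrow> w \<in> set vs)
    \<and> set vs \<subseteq> insert r (\<Union>E)"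
  using assms
proof (induction rule: rtranclp_induct2)
  case refl
  show ?case by auto
next
  case (step st vs st' vs')
  from step.hyps(2) step.IH show ?case by cases auto
qed

lemma dfs_ordering_permutation:
  assumes "connected_graph V E" "dfs_ordering V E vs"
  shows "distinct vs" "set vs = V"
proof -
  from assms obtain r where r: "r \<in> V" "(dfs_step E)\<^sup>*\<^sup>* ([r], [r]) ([], vs)"
    by (auto simp: dfs_ordering_def)
  note inv = dfs_visited_invariant[OF r(2)]
  show "distinct vs" using inv by blast
  have "\<Union>E \<subseteq> V" using assms(1) by (auto simp: connected_graph_def simple_graph_def)
  then have "set vs \<subseteq> V" using inv r(1) by blast
  moreover have "v \<in> set vs" if "v \<in> V" for v
  proof -
    have "(r, v) \<in> {(a, b). {a, b} \<in> E}\<^sup>*" using assms(1) r(1) that by (auto simp: connected_graph_def)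
    then show ?thesis by (induction rule: rtrancl_induct) (use inv in auto)
  qed
  ultimately show "set vs = V" by auto
qed

section \<open>The fused lasso estimator\<close>

abbreviation fused_penalty :: "nat \<Rightarrow> nat list \<Rightarrow> (nat \<Rightarrow> real) \<Rightarrow> real" where
  "fused_penalty n vs \<theta> \<equiv> \<Sum>i\<in>{1..<n}. \<bar>diff_1d (perm_vec vs \<theta>) i\<bar>"

lemma fused_penalty_convex:
  fixes s :: real
  assumes "0 \<le> s" "s \<le> 1"
  shows "fused_penalty n vs (\<lambda>i. (1 - s) * \<theta> i + s * \<theta>' i)
    \<le> (1 - s) * fused_penalty n vs \<theta> + s * fused_penalty n vs \<theta>'"
  unfolding sum_distrib_left sum.distrib[symmetric]
proof (rule sum_mono)
  fix i
  have "diff_1d (perm_vec vs (\<lambda>i. (1 - s) * \<theta> i + s * \<theta>' i)) i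
     = (1 - s) * diff_1d (perm_vec vs \<theta>) i + s * diff_1d (perm_vec vs \<theta>') i"
    by (simp add: diff_1d_def perm_vec_def algebra_simps)
  then show "\<bar>diff_1d (perm_vec vs (\<lambda>i. (1 - s) * \<theta> i + s * \<theta>' i)) i\<bar>
     \<le> (1 - s) * \<bar>diff_1d (perm_vec vs \<theta>) i\<bar> + s * \<bar>diff_1d (perm_vec vs \<theta>') i\<bar>"
    using assms abs_triangle_ineq[of "(1 - s) * diff_1d (perm_vec vs \<theta>) i" "s * diff_1d (perm_vec vs \<theta>') i"]
    by (simp add: abs_mult)
qed

lemma fused_penalty_triangle:
  "fused_penalty n vs (\<lambda>i. \<theta> i - \<theta>' i) \<le> fused_penalty n vs \<theta> + fused_penalty n vs \<theta>'"
  unfolding sum.distrib[symmetric] by (intro sum_mono) (simp add: diff_1d_def perm_vec_def)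

text \<open>A single coordinate far from \<open>y\<close> already costs more than the objective at
  0, so only a box matters. It is compact by Tychonoff, the coordinates outside
  \<open>{1..n}\<close> being pinned to one point.\<close>

lemma fused_lasso_minimizer_exists:
  fixes n vs y
  assumes "lam \<ge> 0"
  shows "\<exists>\<theta>\<in>Rn n. \<forall>\<theta>'\<in>Rn n. fused_lasso_objective n vs lam y \<theta> \<le> fused_lasso_objective n vs lam y \<theta>'"
proof -
  let ?f = "fused_lasso_objective n vs lam y"
  define z where "z = (\<lambda>i. if i \<in> {1..n} then 0 else undefined :: real)"
  define F where "F = ?f z"
  \<comment> \<open>A coordinate beyond \<open>B\<close> is at least \<open>2 * F + 1\<close> away
    from \<open>y i\<close>; the summand 1 makes the square of this distance at least the distance
    itself.\<close>
  define B where "B = (\<Sum>i\<in>{1..n}. \<bar>y i\<bar>) + 2 * F + 1"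
  define S where "S = (\<lambda>i::nat. if i \<in> {1..n} then {-B..B} else {undefined :: real})"
  have fz: "F \<ge> 0" unfolding F_def fused_lasso_objective_def using assms
    by (simp add: sum_nonneg)
  have S_Rn: "PiE UNIV S \<subseteq> Rn n" by (auto simp: S_def PiE_iff extensional_def split: if_splits)
  have "B \<ge> 0" using fz by (auto simp: B_def intro!: add_nonneg_nonneg sum_nonneg)
  then have zS: "z \<in> PiE UNIV S" by (auto simp: S_def z_def)
  have "compactin (product_topology (\<lambda>i. euclidean) UNIV) (PiE UNIV S)"
    unfolding compactin_PiE by (auto simp: S_def)
  then have "compact (PiE UNIV S)"
    by (simp add: euclidean_product_topology)
  moreover have "continuous_on (PiE UNIV S) ?f"
    unfolding fused_lasso_objective_def diff_1d_def perm_vec_def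
    by (intro continuous_intros continuous_on_subset[OF continuous_on_product_coordinates]) auto
  ultimately obtain \<theta> where \<theta>: "\<theta> \<in> PiE UNIV S" "\<And>\<theta>'. \<theta>' \<in> PiE UNIV S \<Longrightarrow> ?f \<theta> \<le> ?f \<theta>'"
    using continuous_attains_inf[of "PiE UNIV S" ?f] zS by blast
  have "?f \<theta> \<le> ?f \<theta>'" if "\<theta>' \<in> Rn n" for \<theta>'
  proof (cases "\<theta>' \<in> PiE UNIV S")
    case False
    then obtain i where S: "\<theta>' i \<notin> S i" by auto
    have i: "i \<in> {1..n}"
    proof (rule ccontr)
      assume nin: "i \<notin> {1..n}"
      show False using S extensional_arb[OF that nin] unfolding S_def if_not_P[OF nin] by simp
    qed
    with S have Bi: "\<bar>\<theta>' i\<bar> > B" by (auto simp: S_def)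
    have "\<bar>y i\<bar> \<le> (\<Sum>i\<in>{1..n}. \<bar>y i\<bar>)" using i by (intro member_le_sum) auto
    then have d: "\<bar>y i - \<theta>' i\<bar> \<ge> 2 * F + 1" using Bi unfolding B_def by linarith
    then have "2 * F \<le> \<bar>y i - \<theta>' i\<bar> * 1" by simp
    also have "\<dots> \<le> \<bar>y i - \<theta>' i\<bar> * \<bar>y i - \<theta>' i\<bar>" using d fz by (intro mult_left_mono) auto
    also have "\<dots> = (y i - \<theta>' i)\<^sup>2" by (simp add: power2_eq_square)
    also have "\<dots> \<le> (\<Sum>i\<in>{1..n}. (y i - \<theta>' i)\<^sup>2)" using i by (intro member_le_sum) auto
    finally have "F \<le> 1/2 * (\<Sum>i\<in>{1..n}. (y i - \<theta>' i)\<^sup>2)" by simp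
    also have "\<dots> \<le> ?f \<theta>'" unfolding fused_lasso_objective_def using assms
      by (simp add: sum_nonneg)
    finally show ?thesis using \<theta>(2)[OF zS] by (simp add: F_def)
  qed (use \<theta> in auto)
  with \<theta>(1) S_Rn show ?thesis by blast
qed

text \<open>\<open>arg_min\<close> is a choice operator, so the existence of a minimizer is what
  gives the estimator this property.\<close>

lemma dfs_fused_lasso_minimizes:
  assumes "lam \<ge> 0"
  shows "dfs_fused_lasso n vs lam y \<in> Rn n"
    and "\<theta> \<in> Rn n \<Longrightarrow>
      fused_lasso_objective n vs lam y (dfs_fused_lasso n vs lam y) \<le> fused_lasso_objective n vs lam y \<theta>"
proof -
  obtain \<theta>0 where "\<theta>0 \<in> Rn n" "\<And>\<theta>'. \<theta>' \<in> Rn n \<Longrightarrow>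
      fused_lasso_objective n vs lam y \<theta>0 \<le> fused_lasso_objective n vs lam y \<theta>'"
    using fused_lasso_minimizer_exists[OF assms, of n vs y] by auto
  then have "is_arg_min (fused_lasso_objective n vs lam y) (\<lambda>\<theta>. \<theta> \<in> Rn n) \<theta>0"
    by (simp add: is_arg_min_linorder)
  then have "is_arg_min (fused_lasso_objective n vs lam y) (\<lambda>\<theta>. \<theta> \<in> Rn n) (dfs_fused_lasso n vs lam y)"
    unfolding dfs_fused_lasso_def arg_min_def
    by (rule someI[where P = "is_arg_min (fused_lasso_objective n vs lam y) (\<lambda>\<theta>. \<theta> \<in> Rn n)"])
  then show "dfs_fused_lasso n vs lam y \<in> Rn n"
    and "\<theta> \<in> Rn n \<Longrightarrow>
      fused_lasso_objective n vs lam y (dfs_fused_lasso n vs lam y) \<le> fused_lasso_objective n vs lam y \<theta>"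
    by (auto simp: is_arg_min_linorder)
qed

text \<open>The estimator is compared with the point a fraction \<open>s\<close> of the way towards
  \<open>\<theta>\<close>. Convexity of the penalty makes the difference linear in \<open>s\<close>
  up to a quadratic term, which disappears after division by \<open>s\<close> as \<open>s\<close>
  tends to 0.\<close>

lemma dfs_fused_lasso_variational_ineq:
  fixes n vs lam y
  assumes "lam \<ge> 0" "\<theta> \<in> Rn n"
  defines "\<theta>h \<equiv> dfs_fused_lasso n vs lam y"
  shows "(\<Sum>i\<in>{1..n}. (y i - \<theta>h i) * (\<theta> i - \<theta>h i))
    \<le> lam * (fused_penalty n vs \<theta> - fused_penalty n vs \<theta>h)"
proof -
  let ?P = "fused_penalty n vs"
  define I where "I = (\<Sum>i\<in>{1..n}. (y i - \<theta>h i) * (\<theta> i - \<theta>h i))"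
  define Q where "Q = (\<Sum>i\<in>{1..n}. (\<theta> i - \<theta>h i)\<^sup>2)"
  have key: "I \<le> lam * (?P \<theta> - ?P \<theta>h) + s / 2 * Q" if s: "0 < s" "s \<le> 1" for s
  proof -
    define w where "w = (\<lambda>i. (1 - s) * \<theta>h i + s * \<theta> i)"
    define w' where "w' = restrict w {1..n}"
    have Pw: "?P w \<le> (1 - s) * ?P \<theta>h + s * ?P \<theta>"
      unfolding w_def using s by (intro fused_penalty_convex) auto
    have Rn: "\<theta>h \<in> Rn n" using dfs_fused_lasso_minimizes(1)[OF assms(1)] by (simp add: \<theta>h_def)
    \<comment> \<open>Outside \<open>{1..n}\<close> both vectors are \<open>undefined\<close>, and
      so is their combination because the weights add up to 1.\<close>
    have w': "w' = w" unfolding w'_def w_def using Rn assms(2)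
      by (auto simp: restrict_def extensional_def fun_eq_iff algebra_simps)
    then have "w \<in> Rn n" unfolding w'_def by (metis restrict_extensional)
    then have "fused_lasso_objective n vs lam y \<theta>h \<le> fused_lasso_objective n vs lam y w"
      unfolding \<theta>h_def by (rule dfs_fused_lasso_minimizes(2)[OF assms(1)])
    moreover have "(\<Sum>i\<in>{1..n}. (y i - w i)\<^sup>2) = (\<Sum>i\<in>{1..n}. (y i - \<theta>h i)\<^sup>2) - 2 * s * I + s\<^sup>2 * Q"
      unfolding I_def Q_def sum_distrib_left sum_subtractf[symmetric] sum.distrib[symmetric] w_def
      by (intro sum.cong) (auto simp: power2_eq_square algebra_simps)
    moreover have "lam * ?P w \<le> lam * ((1 - s) * ?P \<theta>h + s * ?P \<theta>)"
      using Pw assms(1) by (rule mult_left_mono)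
    ultimately have "s * I \<le> s * (lam * (?P \<theta> - ?P \<theta>h) + s / 2 * Q)"
      unfolding fused_lasso_objective_def by (simp add: algebra_simps power2_eq_square)
    with s show ?thesis by simp
  qed
  have "((\<lambda>s. lam * (?P \<theta> - ?P \<theta>h) + s / 2 * Q) \<longlongrightarrow> lam * (?P \<theta> - ?P \<theta>h) + 0 / 2 * Q) (at_right 0)"
    by (intro tendsto_intros) simp
  moreover have "\<forall>\<^sub>F s in at_right 0. I \<le> lam * (?P \<theta> - ?P \<theta>h) + s / 2 * Q"
    by (rule eventually_at_rightI[of 0 1]) (use key in auto)
  ultimately show ?thesis
    using tendsto_lowerbound[of "\<lambda>s. lam * (?P \<theta> - ?P \<theta>h) + s / 2 * Q" _ "at_right 0" I] I_def by simp
qed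

text \<open>The estimator is a proximal map. Adding the variational inequalities of the two data
  vectors, each tested with the other's estimator, cancels the penalties. The result provides
  continuity in the data.\<close>

lemma dfs_fused_lasso_nonexpansive:
  assumes "lam \<ge> 0"
  shows "(\<Sum>i\<in>{1..n}. (dfs_fused_lasso n vs lam y i - dfs_fused_lasso n vs lam y' i)\<^sup>2)
    \<le> (\<Sum>i\<in>{1..n}. (y i - y' i)\<^sup>2)"
proof -
  let ?a = "dfs_fused_lasso n vs lam y" and ?b = "dfs_fused_lasso n vs lam y'"
  have "(\<Sum>i\<in>{1..n}. (y i - ?a i) * (?b i - ?a i)) + (\<Sum>i\<in>{1..n}. (y' i - ?b i) * (?a i - ?b i)) \<le> 0"
    using dfs_fused_lasso_variational_ineq[OF assms dfs_fused_lasso_minimizes(1)[OF assms, of n vs y'], of y vs]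
      dfs_fused_lasso_variational_ineq[OF assms dfs_fused_lasso_minimizes(1)[OF assms, of n vs y], of y' vs]
    by (simp add: algebra_simps)
  then have "(\<Sum>i\<in>{1..n}. (y i - ?a i) * (?b i - ?a i) + (y' i - ?b i) * (?a i - ?b i)) \<le> 0"
    by (simp add: sum.distrib)
  \<comment> \<open>With d the difference of the estimators and h that of the data, the bracket is d
    (d - h), and the claim is that the square of d - h is nonnegative.\<close>
  moreover have "(?a i - ?b i)\<^sup>2
      \<le> 2 * ((y i - ?a i) * (?b i - ?a i) + (y' i - ?b i) * (?a i - ?b i)) + (y i - y' i)\<^sup>2" for i
    using zero_le_power2[of "(?a i - ?b i) - (y i - y' i)"]
    by (simp add: power2_eq_square algebra_simps)
  then have "(\<Sum>i\<in>{1..n}. (?a i - ?b i)\<^sup>2) \<le>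
     2 * (\<Sum>i\<in>{1..n}. (y i - ?a i) * (?b i - ?a i) + (y' i - ?b i) * (?a i - ?b i)) + (\<Sum>i\<in>{1..n}. (y i - y' i)\<^sup>2)"
    unfolding sum_distrib_left sum.distrib[symmetric] by (intro sum_mono) 
  ultimately show ?thesis by linarith
qed

section \<open>Continuity and measurability of the estimator in the data\<close>

lemma dfs_fused_lasso_cong:
  "(\<And>i. i \<in> {1..n} \<Longrightarrow> y i = y' i) \<Longrightarrow> dfs_fused_lasso n vs lam y = dfs_fused_lasso n vs lam y'"
proof -
  assume "\<And>i. i \<in> {1..n} \<Longrightarrow> y i = y' i"
  then have "fused_lasso_objective n vs lam y = fused_lasso_objective n vs lam y'"
    by (auto simp: fused_lasso_objective_def fun_eq_iff)
  then show ?thesis by (simp add: dfs_fused_lasso_def)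
qed

lemma continuous_dfs_fused_lasso:
  assumes "lam \<ge> 0" "i \<in> {1..n}"
  shows "continuous_on UNIV (\<lambda>y. dfs_fused_lasso n vs lam y i)"
proof -
  have "isCont (\<lambda>y. dfs_fused_lasso n vs lam y i) y0" for y0
  proof -
    let ?g = "\<lambda>y. sqrt (\<Sum>j\<in>{1..n}. (y j - y0 j)\<^sup>2)"
    have "continuous_on UNIV ?g"
      by (intro continuous_intros continuous_on_subset[OF continuous_on_product_coordinates]) auto
    then have "isCont ?g y0" by (simp add: continuous_on_eq_continuous_at)
    then have "(?g \<longlongrightarrow> ?g y0) (at y0)" by (simp only: isCont_def)
    then have "(?g \<longlongrightarrow> 0) (at y0)" by simp
    moreover have bound: "norm (dfs_fused_lasso n vs lam y i - dfs_fused_lasso n vs lam y0 i) \<le> ?g y" for y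
    proof -
      have "(dfs_fused_lasso n vs lam y i - dfs_fused_lasso n vs lam y0 i)\<^sup>2
        \<le> (\<Sum>i\<in>{1..n}. (dfs_fused_lasso n vs lam y i - dfs_fused_lasso n vs lam y0 i)\<^sup>2)"
        using assms(2) by (intro member_le_sum) auto
      also have "\<dots> \<le> (\<Sum>j\<in>{1..n}. (y j - y0 j)\<^sup>2)" by (rule dfs_fused_lasso_nonexpansive[OF assms(1)])
      finally show ?thesis by (simp add: real_le_rsqrt)
    qed
    ultimately have "((\<lambda>y. dfs_fused_lasso n vs lam y i - dfs_fused_lasso n vs lam y0 i) \<longlongrightarrow> 0) (at y0)"
      by (intro Lim_null_comparison[OF always_eventually[OF allI[OF bound]]])
    then show ?thesis by (simp add: isCont_def LIM_zero_iff)
  qed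
  then show ?thesis by (simp add: continuous_on_eq_continuous_at)
qed

text \<open>Needed because the rate is a lower bound on the \<open>measure\<close> of an event,
  which is 0 for non-measurable sets.\<close>

lemma measurable_dfs_fused_lasso:
  assumes "lam \<ge> 0" "i \<in> {1..n}" "\<And>j. j \<in> {1..n} \<Longrightarrow> (\<lambda>\<omega>. y j \<omega>) \<in> borel_measurable \<Omega>"
  shows "(\<lambda>\<omega>. dfs_fused_lasso n vs lam (\<lambda>j. y j \<omega>) i) \<in> borel_measurable \<Omega>"
proof -
  \<comment> \<open>Only the coordinates in \<open>{1..n}\<close> are known to be measurable; 0
    elsewhere makes all of them so and leaves the estimator unchanged.\<close>
  define y' where "y' = (\<lambda>\<omega> j. if j \<in> {1..n} then y j \<omega> else 0)"
  have "(\<lambda>\<omega>. y' \<omega> j) \<in> borel_measurable \<Omega>" for j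
  proof (cases "j \<in> {1..n}")
    case True
    then have "(\<lambda>\<omega>. y' \<omega> j) = y j" by (auto simp: y'_def)
    with assms(3)[OF True] show ?thesis by simp
  next
    case False
    then have "(\<lambda>\<omega>. y' \<omega> j) = (\<lambda>_. 0)" by (auto simp: y'_def)
    then show ?thesis by simp
  qed
  then have "y' \<in> borel_measurable \<Omega>"
    by (rule measurable_coordinatewise_then_product)
  then have "(\<lambda>\<omega>. dfs_fused_lasso n vs lam (y' \<omega>) i) \<in> borel_measurable \<Omega>"
    by (rule measurable_compose)
      (rule borel_measurable_continuous_onI[OF continuous_dfs_fused_lasso[OF assms(1,2)]])
  moreover have "dfs_fused_lasso n vs lam (y' \<omega>) = dfs_fused_lasso n vs lam (\<lambda>j. y j \<omega>)" for \<omega>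
    by (rule dfs_fused_lasso_cong) (auto simp: y'_def)
  ultimately show ?thesis by simp
qed

section \<open>Thresholded Haar expansion\<close>

definition block_sum :: "(nat \<Rightarrow> real) \<Rightarrow> nat \<Rightarrow> nat \<Rightarrow> real" where
  "block_sum e j k = (\<Sum>i\<in>{k * 2^j..<k * 2^j + 2^j}. e i)"

definition block_coeff :: "(nat \<Rightarrow> real) \<Rightarrow> nat \<Rightarrow> nat \<Rightarrow> real" where
  "block_coeff e j k = block_sum e j k / sqrt (2^j)"

text \<open>The coefficient for the orthonormal Haar function supported on block \<open>k\<close> of
  level \<open>Suc j\<close>, whose halves are the blocks \<open>2 * k\<close> and
  \<open>2 * k + 1\<close> of level \<open>j\<close>.\<close>

definition haar_coeff :: "(nat \<Rightarrow> real) \<Rightarrow> nat \<Rightarrow> nat \<Rightarrow> real" where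
  "haar_coeff e j k = (block_sum e j (2 * k) - block_sum e j (2 * k + 1)) / sqrt (2 ^ Suc j)"

lemma block_sum_Suc: "block_sum e (Suc j) k = block_sum e j (2 * k) + block_sum e j (2 * k + 1)"
proof -
  have "{k * 2 ^ Suc j..<k * 2 ^ Suc j + 2 ^ Suc j} =
      {2 * k * 2 ^ j..<2 * k * 2 ^ j + 2 ^ j} \<union> {(2 * k + 1) * 2 ^ j..<(2 * k + 1) * 2 ^ j + 2 ^ j}"
    by (auto simp: algebra_simps)
  then show ?thesis unfolding block_sum_def
    by (simp only:) (rule sum.union_disjoint; auto simp: algebra_simps)
qed

text \<open>Passing from two neighbouring block coefficients to their normalized sum and difference
  is an orthogonal map of the plane, so it preserves inner products.\<close>

lemma block_coeff_split:
  "block_coeff e j (2 * k) * block_coeff v j (2 * k) + block_coeff e j (2 * k + 1) * block_coeff v j (2 * k + 1)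
    = block_coeff e (Suc j) k * block_coeff v (Suc j) k + haar_coeff e j k * haar_coeff v j k"
proof -
  have [simp]: "a / sqrt (2 ^ i) * (b / sqrt (2 ^ i)) = a * b / 2 ^ i" for a b and i :: nat
    by simp
  show ?thesis unfolding block_coeff_def haar_coeff_def block_sum_Suc
    by (simp add: field_simps del: power_Suc) (simp add: algebra_simps)
qed

lemma sum_lessThan_double:
  fixes f :: "nat \<Rightarrow> real"
  shows "(\<Sum>k<2 * n. f k) = (\<Sum>k<n. f (2 * k) + f (2 * k + 1))"
  by (induction n) (auto simp: add.assoc)

text \<open>Parseval's identity for the expansion stopped at level \<open>m\<close>, obtained by
  merging neighbouring blocks level by level.\<close>

lemma haar_expansion:
  assumes "m \<le> J"
  shows "(\<Sum>i<2^J. e i * v i) = (\<Sum>k<2^(J - m). block_coeff e m k * block_coeff v m k)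
    + (\<Sum>j<m. \<Sum>k<2^(J - Suc j). haar_coeff e j k * haar_coeff v j k)"
  using assms
proof (induction m)
  case 0
  then show ?case by (simp add: block_coeff_def block_sum_def)
next
  case (Suc m)
  have J: "(2::nat) ^ (J - m) = 2 * 2 ^ (J - Suc m)"
    using Suc.prems by (metis Suc_diff_Suc Suc_le_lessD power_Suc)
  have "(\<Sum>k<2^(J - m). block_coeff e m k * block_coeff v m k) =
      (\<Sum>k<2^(J - Suc m). block_coeff e (Suc m) k * block_coeff v (Suc m) k)
      + (\<Sum>k<2^(J - Suc m). haar_coeff e m k * haar_coeff v m k)"
    unfolding J sum_lessThan_double block_coeff_split sum.distrib ..
  then show ?case using Suc by simp
qed

lemma sum_block_sum:
  assumes "j \<le> J"
  shows "(\<Sum>k<2^(J - j). block_sum g j k) = (\<Sum>i<2^J. g i)"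
  unfolding block_sum_def sum.nat_group using assms by (simp flip: power_add)

text \<open>Entries of the two halves are paired at distance \<open>2^j\<close>; each difference is
  at most the variation over the whole block. The increment leaving the block is included, so that
  the variations of the blocks add up to the total one.\<close>

lemma abs_haar_coeff_le:
  "\<bar>haar_coeff v j k\<bar> \<le> sqrt (2^j) * block_sum (\<lambda>i. \<bar>v (Suc i) - v i\<bar>) (Suc j) k"
proof -
  let ?B = "block_sum (\<lambda>i. \<bar>v (Suc i) - v i\<bar>) (Suc j) k"
  define a where "a = 2 * k * 2 ^ j"
  have 1: "block_sum v j (2 * k) = (\<Sum>i<2^j. v (i + a))"
    and 2: "block_sum v j (2 * k + 1) = (\<Sum>i<2^j. v (i + a + 2^j))"
    unfolding block_sum_def a_def
    using sum.shift_bounds_nat_ivl[of v 0 "2 * k * 2 ^ j" "2^j"]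
      sum.shift_bounds_nat_ivl[of v 0 "2 * k * 2 ^ j + 2 ^ j" "2^j"]
    by (simp_all add: algebra_simps lessThan_atLeast0)
  have B: "\<bar>v (i + a) - v (i + a + 2^j)\<bar> \<le> ?B" if "i < 2^j" for i
  proof -
    have "v (i + a + 2^j) - v (i + a) = (\<Sum>l\<in>{i + a..<i + a + 2^j}. v (Suc l) - v l)"
      by (simp add: sum_Suc_diff')
    then have "\<bar>v (i + a + 2^j) - v (i + a)\<bar> \<le> (\<Sum>l\<in>{i + a..<i + a + 2^j}. \<bar>v (Suc l) - v l\<bar>)"
      by (simp add: sum_abs)
    also have "\<dots> \<le> ?B" unfolding block_sum_def using that
      by (intro sum_mono2) (auto simp: a_def)
    finally show ?thesis by (simp add: abs_minus_commute)
  qed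
  have "\<bar>block_sum v j (2 * k) - block_sum v j (2 * k + 1)\<bar> \<le> (\<Sum>i<2^j. \<bar>v (i + a) - v (i + a + 2^j)\<bar>)"
    unfolding 1 2 sum_subtractf[symmetric] by (rule sum_abs)
  also have "\<dots> \<le> (\<Sum>i<(2::nat)^j. ?B)" using B by (intro sum_mono) auto
  also have "\<dots> = 2^j * ?B" by simp
  finally have "\<bar>haar_coeff v j k\<bar> \<le> 2^j * ?B / sqrt (2^Suc j)"
    unfolding haar_coeff_def abs_divide by (simp add: divide_right_mono)
  also have "\<dots> \<le> 2^j * ?B / sqrt (2^j)"
    by (intro divide_left_mono mult_nonneg_nonneg)
      (auto simp: block_sum_def intro!: sum_nonneg real_sqrt_le_mono mult_pos_pos)
  also have "\<dots> = sqrt (2^j) * ?B"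
    by (simp add: real_div_sqrt flip: times_divide_eq_left)
  finally show ?thesis .
qed

section \<open>Soft thresholding of the coefficients\<close>

definition excess :: "real \<Rightarrow> real \<Rightarrow> real" where
  "excess \<tau> z = (max 0 (\<bar>z\<bar> - \<tau>))\<^sup>2"

lemma excess_nonneg: "excess \<tau> z \<ge> 0"
  by (simp add: excess_def)

text \<open>\<open>z\<close> is split into its part up to \<tau> and the rest, and Young's
  inequality is applied to the rest. The weight 1/8 becomes 1/4 when reflection doubles the squared
  norm.\<close>

lemma mult_le_excess:
  assumes "\<tau> \<ge> 0"
  shows "z * w \<le> 2 * excess \<tau> z + w\<^sup>2 / 8 + \<tau> * \<bar>w\<bar>"
proof -
  define p where "p = max 0 (\<bar>z\<bar> - \<tau>)"
  have "z * w \<le> \<bar>z\<bar> * \<bar>w\<bar>" by (metis abs_ge_self abs_mult)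
  also have "\<dots> \<le> (p + \<tau>) * \<bar>w\<bar>" by (rule mult_right_mono) (auto simp: p_def)
  also have "p * \<bar>w\<bar> \<le> 2 * p\<^sup>2 + w\<^sup>2 / 8"
    using zero_le_power2[of "4 * p - \<bar>w\<bar>"] by (simp add: power2_eq_square algebra_simps)
  then have "(p + \<tau>) * \<bar>w\<bar> \<le> 2 * p\<^sup>2 + w\<^sup>2 / 8 + \<tau> * \<bar>w\<bar>" by (simp add: algebra_simps)
  finally show ?thesis by (simp add: excess_def p_def)
qed

text \<open>Reduces the expected excess to exponential moments, with the factor
  \<open>exp (-\<tau>)\<close> that will outweigh the number of coefficients on the finer
  levels.\<close>

lemma excess_le_exp:
  assumes "\<tau> \<ge> 0"
  shows "excess \<tau> z \<le> 2 * exp (-\<tau>) * (exp z + exp (-z))"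
proof (cases "\<bar>z\<bar> \<le> \<tau>")
  case True
  then show ?thesis by (simp add: excess_def max_def)
next
  case False
  then have "excess \<tau> z = (\<bar>z\<bar> - \<tau>)\<^sup>2" by (simp add: excess_def)
  also have "\<dots> \<le> 2 * exp (\<bar>z\<bar> - \<tau>)"
    using False exp_lower_Taylor_quadratic[of "\<bar>z\<bar> - \<tau>"] by simp
  also have "\<dots> = 2 * exp (-\<tau>) * exp \<bar>z\<bar>" by (simp add: exp_diff exp_minus field_simps)
  also have "\<dots> \<le> 2 * exp (-\<tau>) * (exp z + exp (-z))"
    by (intro mult_left_mono) (auto simp: abs_if)
  finally show ?thesis .
qed

text \<open>The thresholds grow with the distance \<open>m - j\<close> to the coarsest level \<open>m\<close>: slowly enough to be
  paid for by the total variation, and fast enough for the excess over all levels to be comparable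
  to the number of the coarsest blocks. This is what avoids a logarithmic factor.\<close>

definition haar_energy :: "nat \<Rightarrow> nat \<Rightarrow> (nat \<Rightarrow> real) \<Rightarrow> real" where
  "haar_energy J m e = (\<Sum>k<2^(J - m). excess 0 (block_coeff e m k))
     + (\<Sum>j<m. \<Sum>k<2^(J - Suc j). excess (real (m - j)) (haar_coeff e j k))"

lemma haar_energy_nonneg: "haar_energy J m e \<ge> 0"
  unfolding haar_energy_def by (intro add_nonneg_nonneg sum_nonneg excess_nonneg)

lemma inner_product_le_haar_energy:
  assumes "m \<le> J"
  shows "(\<Sum>i<2^J. e i * v i) \<le> 2 * haar_energy J m e + (\<Sum>i<2^J. (v i)\<^sup>2) / 8
    + (\<Sum>j<m. real (m - j) * sqrt (2^j)) * (\<Sum>i<2^J. \<bar>v (Suc i) - v i\<bar>)"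
proof -
  let ?V = "\<Sum>i<2^J. \<bar>v (Suc i) - v i\<bar>"
  have V: "(\<Sum>k<2^(J - Suc j). real (m - j) * \<bar>haar_coeff v j k\<bar>) \<le> real (m - j) * sqrt (2^j) * ?V"
    if "j < m" for j
  proof -
    have "(\<Sum>k<2^(J - Suc j). real (m - j) * \<bar>haar_coeff v j k\<bar>) \<le>
        (\<Sum>k<2^(J - Suc j). real (m - j) * (sqrt (2^j) * block_sum (\<lambda>i. \<bar>v (Suc i) - v i\<bar>) (Suc j) k))"
      by (intro sum_mono mult_left_mono abs_haar_coeff_le) auto
    also have "\<dots> = real (m - j) * sqrt (2^j) * ?V"
      using sum_block_sum[of "Suc j" J "\<lambda>i. \<bar>v (Suc i) - v i\<bar>"] that assms
      by (simp add: mult.assoc flip: sum_distrib_left)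
    finally show ?thesis .
  qed
  have coarse: "z * w \<le> 2 * excess 0 z + w\<^sup>2 / 8" for z w
    using mult_le_excess[of 0 z w] by simp
  have "(\<Sum>i<2^J. e i * v i) = (\<Sum>k<2^(J - m). block_coeff e m k * block_coeff v m k)
    + (\<Sum>j<m. \<Sum>k<2^(J - Suc j). haar_coeff e j k * haar_coeff v j k)"
    by (rule haar_expansion[OF assms])
  also have "\<dots> \<le> (\<Sum>k<2^(J - m). 2 * excess 0 (block_coeff e m k) + (block_coeff v m k)\<^sup>2 / 8)
    + (\<Sum>j<m. \<Sum>k<2^(J - Suc j). 2 * excess (real (m - j)) (haar_coeff e j k)
        + (haar_coeff v j k)\<^sup>2 / 8 + real (m - j) * \<bar>haar_coeff v j k\<bar>)"
    by (intro add_mono[OF sum_mono[OF coarse]] sum_mono mult_le_excess) auto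
  also have "\<dots> = 2 * haar_energy J m e
    + ((\<Sum>k<2^(J - m). block_coeff v m k * block_coeff v m k)
      + (\<Sum>j<m. \<Sum>k<2^(J - Suc j). haar_coeff v j k * haar_coeff v j k)) / 8
    + (\<Sum>j<m. \<Sum>k<2^(J - Suc j). real (m - j) * \<bar>haar_coeff v j k\<bar>)"
    unfolding haar_energy_def
    by (simp add: sum.distrib power2_eq_square add_divide_distrib sum_distrib_left sum_divide_distrib
        add_ac)
  \<comment> \<open>Parseval is used backwards here: the squared coefficients of \<open>v\<close>
    reassemble to its squared norm.\<close>
  also have "\<dots> \<le> 2 * haar_energy J m e + (\<Sum>i<2^J. v i * v i) / 8
    + (\<Sum>j<m. real (m - j) * sqrt (2^j) * ?V)"
    unfolding haar_expansion[OF assms, symmetric] by (intro add_left_mono sum_mono V) auto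
  finally show ?thesis by (simp add: power2_eq_square sum_distrib_right)
qed

text \<open>The sum of the series of (k + 1) q^k at q = 1 / sqrt 2.\<close>

definition level_const :: real where
  "level_const = 1 / (1 - 1 / sqrt 2)\<^sup>2"

text \<open>Indexed by the distance from the coarsest level, the terms decay like the derivative of
  a geometric series, so the coarsest level determines the order.\<close>

lemma sum_threshold_le:
  "(\<Sum>j<m. real (m - j) * sqrt (2^j)) \<le> level_const * sqrt (2^m)"
proof -
  define q where "q = 1 / sqrt 2"
  have q: "0 < q" "q < 1" by (auto simp: q_def)
  have "(\<Sum>j<m. real (m - j) * sqrt (2^j)) = (\<Sum>k<m. real (m - (m - Suc k)) * sqrt (2^(m - Suc k)))"
    by (rule sum.nat_diff_reindex[symmetric])
  also have "\<dots> \<le> (\<Sum>k<m. sqrt (2^m) * (real (Suc k) * q ^ k))"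
  proof (rule sum_mono)
    fix k assume "k \<in> {..<m}"
    then have k: "m = (m - Suc k) + Suc k" by simp
    have "sqrt (2 ^ m) = sqrt (2 ^ (m - Suc k)) * sqrt 2 ^ Suc k"
      by (subst k, subst power_add) (simp only: real_sqrt_mult real_sqrt_power)
    then have "sqrt (2 ^ m) * q ^ Suc k = sqrt (2 ^ (m - Suc k))"
      by (simp add: q_def power_divide del: power_Suc)
    moreover have "sqrt (2 ^ m) * q ^ Suc k \<le> sqrt (2 ^ m) * q ^ k"
      using q by (intro mult_left_mono power_decreasing) auto
    ultimately have "sqrt (2 ^ (m - Suc k)) \<le> sqrt (2 ^ m) * q ^ k" by simp
    then have "real (Suc k) * sqrt (2 ^ (m - Suc k)) \<le> real (Suc k) * (sqrt (2 ^ m) * q ^ k)"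
      by (intro mult_left_mono) auto
    moreover have "m - (m - Suc k) = Suc k" using k by simp
    ultimately show "real (m - (m - Suc k)) * sqrt (2^(m - Suc k)) \<le> sqrt (2^m) * (real (Suc k) * q ^ k)"
      by (simp only: mult.left_commute)
  qed
  also have "\<dots> = (\<Sum>k<m. real (Suc k) * q ^ k) * sqrt (2^m)"
    by (simp only: sum_distrib_left mult.commute)
  also have "(\<Sum>k<m. real (Suc k) * q ^ k) \<le> 1 / (1 - q)\<^sup>2"
    using geometric_deriv_sums[of q] q by (intro sum_le_suminf[THEN order.trans])
      (auto simp: sums_iff)
  then have "(\<Sum>k<m. real (Suc k) * q ^ k) * sqrt (2^m) \<le> 1 / (1 - q)\<^sup>2 * sqrt (2^m)"
    by (rule mult_right_mono) auto
  finally show ?thesis by (simp only: q_def level_const_def)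
qed

text \<open>One level finer, the number of coefficients doubles, but the threshold grows by 1. The
  ratio 2 / e is at most 4/5 as e is at least 5/2, and the geometric series with ratio 4/5 sums to
  5.\<close>

lemma sum_exp_threshold_le:
  assumes "m \<le> J"
  shows "(\<Sum>j<m. 2^(J - Suc j) * exp (- real (m - j))) \<le> 5 * 2^(J - m)"
proof -
  define r :: real where "r = 2 * exp (-1)"
  have "exp (1::real) \<ge> 5/2" using exp_lower_Taylor_quadratic[of 1] by simp
  then have r: "0 \<le> r" "r \<le> 4/5" by (auto simp: r_def exp_minus field_simps)
  have "(\<Sum>j<m. 2^(J - Suc j) * exp (- real (m - j)))
      = (\<Sum>k<m. 2^(J - Suc (m - Suc k)) * exp (- real (m - (m - Suc k))))"
    by (rule sum.nat_diff_reindex[symmetric])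
  also have "\<dots> \<le> (\<Sum>k<m. 2^(J - m) * (4/5) ^ k)"
  proof (rule sum_mono)
    fix k assume "k \<in> {..<m}"
    then have eq: "J - Suc (m - Suc k) = (J - m) + k" "m - (m - Suc k) = Suc k" using assms by auto
    have "exp (- real (Suc k)) = exp (-1) ^ Suc k"
      using exp_of_nat_mult[of "Suc k" "-1 :: real"] by simp
    then have "2 ^ k * exp (- real (Suc k)) = r ^ k * exp (-1)"
      by (simp add: r_def power_mult_distrib)
    also have "\<dots> \<le> (4/5)^k * 1" using r by (intro mult_mono power_mono) auto
    finally show "2^(J - Suc (m - Suc k)) * exp (- real (m - (m - Suc k))) \<le> 2^(J - m) * (4/5) ^ k"
      unfolding eq power_add by (simp add: mult.assoc)
  qed
  also have "\<dots> = 2^(J - m) * (\<Sum>k<m. (4/5) ^ k)" by (simp add: sum_distrib_left)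
  also have "(\<Sum>k<m. (4/5::real) ^ k) \<le> 5"
    using geometric_sums[of "4/5::real"] by (intro sum_le_suminf[THEN order.trans]) (auto simp: sums_iff)
  then have "2^(J - m) * (\<Sum>k<m. (4/5::real) ^ k) \<le> 2^(J - m) * 5" by (rule mult_left_mono) auto
  finally show ?thesis by (simp add: mult.commute)
qed

section \<open>Haar coefficients of sub-Gaussian noise\<close>

text \<open>Serves to list the errors in the order of the search while keeping their
  independence.\<close>

lemma (in prob_space) indep_sets_reindex:
  assumes inj: "inj_on f I" and indep: "indep_sets F (f ` I)"
  shows "indep_sets (\<lambda>i. F (f i)) I"
proof (rule indep_setsI)
  show "F (f i) \<subseteq> events" if "i \<in> I" for i
    using indep that by (auto simp: indep_sets_def)
next
  fix A J assume J: "J \<noteq> {}" "J \<subseteq> I" "finite J" "\<forall>j\<in>J. A j \<in> F (f j)"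
  have inv: "the_inv_into I f (f j) = j" if "j \<in> J" for j
    using inj J(2) that by (intro the_inv_into_f_f) auto
  have "prob (\<Inter>k\<in>f ` J. A (the_inv_into I f k)) = (\<Prod>k\<in>f ` J. prob (A (the_inv_into I f k)))"
    using J inv by (intro indep_setsD[OF indep]) auto
  then show "prob (\<Inter>j\<in>J. A j) = (\<Prod>j\<in>J. prob (A j))"
    using inv inj_on_subset[OF inj J(2)] by (simp add: prod.reindex)
qed

lemma (in prob_space) indep_vars_reindex:
  assumes "inj_on f I" "indep_vars M' X (f ` I)"
  shows "indep_vars (\<lambda>i. M' (f i)) (\<lambda>i. X (f i)) I"
  using assms indep_sets_reindex[of f I "\<lambda>i. {X i -` A \<inter> space M |A. A \<in> sets (M' i)}"]
  by (auto simp: indep_vars_def2)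

text \<open>With z = a x, exp z is at most 1 + z exp z, and the remainder z (exp z - 1) is at most
  z^2 exp |z|. The factor \<open>a\<^sup>2\<close> is kept outside, so that for a centred variable
  the excess over 1 of the moment generating function is quadratic in \<open>a\<close>.\<close>

lemma exp_le_Taylor:
  fixes a x :: real
  assumes "\<bar>a\<bar> \<le> 1"
  shows "exp (a * x) \<le> 1 + a * x + 2 * a\<^sup>2 * exp (2 * \<bar>x\<bar>)"
proof -
  have le: "exp z - 1 \<le> z * exp z" for z :: real
    using exp_ge_add_one_self[of "-z"] by (simp add: exp_minus field_simps)
  define z where "z = a * x"
  have zx: "\<bar>z\<bar> \<le> \<bar>x\<bar>" using assms by (simp add: z_def abs_mult mult_left_le_one_le)
  have abs_le: "\<bar>exp z - 1\<bar> \<le> \<bar>z\<bar> * exp \<bar>z\<bar>"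
  proof (cases "z \<ge> 0")
    case False
    then have "\<bar>exp z - 1\<bar> = 1 - exp z" by simp
    also have "\<dots> \<le> \<bar>z\<bar> * 1" using exp_ge_add_one_self[of z] False by linarith
    also have "\<dots> \<le> \<bar>z\<bar> * exp \<bar>z\<bar>" by (intro mult_left_mono) auto
    finally show ?thesis .
  qed (use le[of z] in auto)
  have "z * (exp z - 1) \<le> \<bar>z\<bar> * \<bar>exp z - 1\<bar>" by (metis abs_ge_self abs_mult)
  also have "\<dots> \<le> \<bar>z\<bar> * (\<bar>z\<bar> * exp \<bar>z\<bar>)" using abs_le by (rule mult_left_mono) auto
  also have "\<dots> = z\<^sup>2 * exp \<bar>z\<bar>" by (simp add: power2_eq_square flip: mult.assoc)
  also have "\<dots> = a\<^sup>2 * (x\<^sup>2 * exp \<bar>z\<bar>)" by (simp add: z_def power_mult_distrib)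
  also have "\<dots> \<le> a\<^sup>2 * ((2 * exp \<bar>x\<bar>) * exp \<bar>x\<bar>)"
  proof (intro mult_left_mono mult_mono)
    show "x\<^sup>2 \<le> 2 * exp \<bar>x\<bar>" using exp_lower_Taylor_quadratic[of "\<bar>x\<bar>"] by simp
  qed (use zx in auto)
  also have "\<dots> = 2 * a\<^sup>2 * exp (2 * \<bar>x\<bar>)" by (simp add: mult_exp_exp)
  finally have "z * (exp z - 1) \<le> 2 * a\<^sup>2 * exp (2 * \<bar>x\<bar>)" .
  with le[of z] show ?thesis by (simp add: z_def algebra_simps)
qed

definition exp_moment_bound :: "real \<Rightarrow> real \<Rightarrow> real" where
  "exp_moment_bound M \<sigma> = 1 + M * exp (2 + 9 * \<sigma>\<^sup>2 / 2) / (1 - exp (-1))"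

lemma sub_gaussian_exp_moment:
  assumes "prob_space \<Omega>" "M > 0" "\<sigma> > 0" "sub_gaussian \<Omega> M \<sigma> X"
  shows "integrable \<Omega> (\<lambda>\<omega>. exp (2 * \<bar>X \<omega>\<bar>))"
    and "(\<integral>\<omega>. exp (2 * \<bar>X \<omega>\<bar>) \<partial>\<Omega>) \<le> exp_moment_bound M \<sigma>"
proof -
  interpret prob_space \<Omega> by fact
  have tail: "prob {\<omega>\<in>space \<Omega>. \<bar>X \<omega>\<bar> > u} \<le> M * exp (- (u\<^sup>2 / (2 * \<sigma>\<^sup>2)))" if "u \<ge> 0" for u
    using assms(4) that by (auto simp: sub_gaussian_def)
  have [measurable]: "X \<in> borel_measurable \<Omega>" using assms(4) by (auto simp: sub_gaussian_def)
  define C where "C = M * exp (2 + 9 * \<sigma>\<^sup>2 / 2)"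
  have C: "C \<ge> 0" using assms by (simp add: C_def)
  define A where "A k = {\<omega>\<in>space \<Omega>. \<bar>X \<omega>\<bar> > real k}" for k
  have [measurable]: "A k \<in> sets \<Omega>" for k unfolding A_def by measurable
  \<comment> \<open>A nonzero value lies in exactly one interval (k, k + 1]; the summand 1 takes
    care of the value 0.\<close>
  have layer: "ennreal (exp (2 * \<bar>X \<omega>\<bar>)) \<le> 1 + (\<Sum>k. ennreal (exp (2 * (real k + 1))) * indicator (A k) \<omega>)"
    if "\<omega> \<in> space \<Omega>" for \<omega>
  proof (cases "X \<omega> = 0")
    case False
    define k where "k = nat (\<lceil>\<bar>X \<omega>\<bar>\<rceil> - 1)"
    define f where "f = (\<lambda>k. ennreal (exp (2 * (real k + 1))) * indicator (A k) \<omega>)"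
    have k: "real k < \<bar>X \<omega>\<bar>" "\<bar>X \<omega>\<bar> \<le> real k + 1" using False unfolding k_def by linarith+
    have "ennreal (exp (2 * \<bar>X \<omega>\<bar>)) \<le> ennreal (exp (2 * (real k + 1))) * indicator (A k) \<omega>"
      using k that by (auto simp: A_def intro!: ennreal_leI)
    also have "\<dots> = f k" by (simp add: f_def)
    also have "\<dots> \<le> suminf f"
      using sum_le_suminf[of f "{k}"] by simp
    also have "\<dots> \<le> 1 + suminf f" by simp
    finally show ?thesis by (simp add: f_def)
  qed simp
  have term_le: "exp (2 * (real k + 1)) * prob (A k) \<le> C * exp (-1) ^ k" for k
  proof -
    \<comment> \<open>Completing the square at 3 \<sigma>^2. Of the 3 k gained from the Gaussian
      tail, 2 k pays for the exponent and k remains for geometric decay.\<close>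
    have "2 * (real k * \<sigma>) * (3 * \<sigma>) \<le> (real k)\<^sup>2 + 9 * \<sigma> ^ 2 * \<sigma>\<^sup>2"
      using zero_le_power2[of "real k - 3 * \<sigma>\<^sup>2"] by (simp add: power2_eq_square algebra_simps)
    then have "3 * real k \<le> (real k)\<^sup>2 / (2 * \<sigma>\<^sup>2) + 9 * \<sigma>\<^sup>2 / 2"
      using assms(3) by (simp add: field_simps power2_eq_square)
    then have "2 * (real k + 1) - (real k)\<^sup>2 / (2 * \<sigma>\<^sup>2) \<le> 2 + 9 * \<sigma>\<^sup>2 / 2 + real k * (-1)" by simp
    then have "exp (2 * (real k + 1) - (real k)\<^sup>2 / (2 * \<sigma>\<^sup>2)) \<le> exp (2 + 9 * \<sigma>\<^sup>2 / 2 + real k * (-1))"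
      by (simp only: exp_le_cancel_iff)
    then have *: "M * exp (2 * (real k + 1) - (real k)\<^sup>2 / (2 * \<sigma>\<^sup>2)) \<le> C * exp (-1) ^ k"
      using assms(2) unfolding C_def exp_of_nat_mult[symmetric] mult.assoc mult_exp_exp
      by (intro mult_left_mono) auto
    have "exp (2 * (real k + 1)) * prob (A k) \<le> exp (2 * (real k + 1)) * (M * exp (- ((real k)\<^sup>2 / (2 * \<sigma>\<^sup>2))))"
      unfolding A_def by (intro mult_left_mono tail) auto
    also have "\<dots> = M * exp (2 * (real k + 1) - (real k)\<^sup>2 / (2 * \<sigma>\<^sup>2))"
      by (simp add: exp_diff exp_minus field_simps)
    finally show ?thesis using * by simp
  qed
  have "(\<integral>\<^sup>+\<omega>. exp (2 * \<bar>X \<omega>\<bar>) \<partial>\<Omega>)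
      \<le> (\<integral>\<^sup>+\<omega>. 1 + (\<Sum>k. ennreal (exp (2 * (real k + 1))) * indicator (A k) \<omega>) \<partial>\<Omega>)"
    by (intro nn_integral_mono layer)
  also have "\<dots> = 1 + (\<Sum>k. ennreal (exp (2 * (real k + 1))) * emeasure \<Omega> (A k))"
    by (simp add: nn_integral_add nn_integral_suminf nn_integral_cmult emeasure_space_1)
  also have "\<dots> = 1 + (\<Sum>k. ennreal (exp (2 * (real k + 1)) * prob (A k)))"
    by (simp add: emeasure_eq_measure ennreal_mult)
  also have "\<dots> \<le> 1 + (\<Sum>k. ennreal (C * exp (-1) ^ k))"
    by (intro add_left_mono suminf_le ennreal_leI term_le) auto
  also have "(\<Sum>k. ennreal (C * exp (-1) ^ k)) = ennreal (C / (1 - exp (-1)))"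
    using sums_mult[OF geometric_sums[of "exp (-1) :: real"], of C] C
    by (intro suminf_ennreal_eq) auto
  also have "1 + \<dots> = ennreal (exp_moment_bound M \<sigma>)"
    using C by (simp add: exp_moment_bound_def C_def flip: ennreal_1 ennreal_plus)
  finally have fin: "(\<integral>\<^sup>+\<omega>. exp (2 * \<bar>X \<omega>\<bar>) \<partial>\<Omega>) \<le> ennreal (exp_moment_bound M \<sigma>)" .
  show int: "integrable \<Omega> (\<lambda>\<omega>. exp (2 * \<bar>X \<omega>\<bar>))"
    using fin by (intro integrableI_bounded) (auto simp: le_less_trans)
  have "exp_moment_bound M \<sigma> \<ge> 0" using C by (simp add: exp_moment_bound_def C_def)
  then show "(\<integral>\<omega>. exp (2 * \<bar>X \<omega>\<bar>) \<partial>\<Omega>) \<le> exp_moment_bound M \<sigma>"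
    using fin nn_integral_eq_integral[OF int] by simp
qed

text \<open>The linear Taylor term integrates to 0. The range of \<open>a\<close> suffices because
  the coefficients of a unit vector are at most 1 in absolute value.\<close>

lemma sub_gaussian_mgf:
  assumes "prob_space \<Omega>" "M > 0" "\<sigma> > 0" "sub_gaussian \<Omega> M \<sigma> X" "\<bar>a\<bar> \<le> 1"
  shows "integrable \<Omega> (\<lambda>\<omega>. exp (a * X \<omega>))"
    and "(\<integral>\<omega>. exp (a * X \<omega>) \<partial>\<Omega>) \<le> exp (2 * exp_moment_bound M \<sigma> * a\<^sup>2)"
proof -
  interpret prob_space \<Omega> by fact
  note exp2 = sub_gaussian_exp_moment[OF assms(1-4)]
  have X: "integrable \<Omega> X" "expectation X = 0" using assms(4) by (auto simp: sub_gaussian_def)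
  then have [measurable]: "X \<in> borel_measurable \<Omega>" by auto
  have dom: "integrable \<Omega> (\<lambda>\<omega>. 1 + a * X \<omega> + 2 * a\<^sup>2 * exp (2 * \<bar>X \<omega>\<bar>))"
    using X(1) exp2(1) by auto
  show int: "integrable \<Omega> (\<lambda>\<omega>. exp (a * X \<omega>))"
    by (rule Bochner_Integration.integrable_bound[OF dom])
      (auto intro!: AE_I2 order.trans[OF exp_le_Taylor[OF assms(5)]])
  have "(\<integral>\<omega>. exp (a * X \<omega>) \<partial>\<Omega>) \<le> (\<integral>\<omega>. 1 + a * X \<omega> + 2 * a\<^sup>2 * exp (2 * \<bar>X \<omega>\<bar>) \<partial>\<Omega>)"
    by (intro integral_mono int dom exp_le_Taylor assms(5))
  also have "\<dots> = 1 + 2 * a\<^sup>2 * (\<integral>\<omega>. exp (2 * \<bar>X \<omega>\<bar>) \<partial>\<Omega>)"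
    using X exp2(1) by (simp add: prob_space)
  also have "\<dots> \<le> 1 + 2 * a\<^sup>2 * exp_moment_bound M \<sigma>"
    by (intro add_left_mono mult_left_mono exp2) auto
  also have "\<dots> \<le> exp (2 * exp_moment_bound M \<sigma> * a\<^sup>2)"
    using exp_ge_add_one_self[of "2 * exp_moment_bound M \<sigma> * a\<^sup>2"] by (simp add: mult_ac)
  finally show "(\<integral>\<omega>. exp (a * X \<omega>) \<partial>\<Omega>) \<le> exp (2 * exp_moment_bound M \<sigma> * a\<^sup>2)" .
qed

locale sub_gaussian_noise = prob_space \<Omega> for \<Omega> :: "'a measure" +
  fixes n :: nat and X :: "nat \<Rightarrow> 'a \<Rightarrow> real" and D :: real
  assumes indep: "indep_vars (\<lambda>_. borel) X {..<n}"
    and mgf_integrable: "i < n \<Longrightarrow> \<bar>a\<bar> \<le> 1 \<Longrightarrow> integrable \<Omega> (\<lambda>\<omega>. exp (a * X i \<omega>))"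
    and mgf_le: "i < n \<Longrightarrow> \<bar>a\<bar> \<le> 1 \<Longrightarrow> expectation (\<lambda>\<omega>. exp (a * X i \<omega>)) \<le> exp (D * a\<^sup>2)"
    and D_nonneg: "D \<ge> 0"
begin

text \<open>Padded with 0 because the Haar expansion runs over a power of two.\<close>

definition noise :: "'a \<Rightarrow> nat \<Rightarrow> real" where
  "noise \<omega> i = (if i < n then X i \<omega> else 0)"

lemma mgf_linear_combination:
  assumes "(\<Sum>i<n. (c i)\<^sup>2) \<le> 1"
  shows "integrable \<Omega> (\<lambda>\<omega>. exp (\<Sum>i<n. c i * X i \<omega>))"
    and "expectation (\<lambda>\<omega>. exp (\<Sum>i<n. c i * X i \<omega>)) \<le> exp D"
proof -
  have c: "\<bar>c i\<bar> \<le> 1" if "i < n" for i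
  proof -
    have "(c i)\<^sup>2 \<le> (\<Sum>i<n. (c i)\<^sup>2)" using that by (intro member_le_sum) auto
    with assms have "(c i)\<^sup>2 \<le> 1" by simp
    then show ?thesis by (simp add: abs_square_le_1)
  qed
  have ind: "indep_vars (\<lambda>_. borel) (\<lambda>i \<omega>. exp (c i * X i \<omega>)) {..<n}"
    by (rule indep_vars_compose2[OF indep]) auto
  show "integrable \<Omega> (\<lambda>\<omega>. exp (\<Sum>i<n. c i * X i \<omega>))"
    unfolding exp_sum[OF finite_lessThan]
    by (rule indep_vars_integrable[OF _ ind]) (auto intro: mgf_integrable c)
  have "expectation (\<lambda>\<omega>. exp (\<Sum>i<n. c i * X i \<omega>)) = (\<Prod>i<n. expectation (\<lambda>\<omega>. exp (c i * X i \<omega>)))"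
    unfolding exp_sum[OF finite_lessThan]
    by (rule indep_vars_lebesgue_integral[OF _ ind]) (auto intro: mgf_integrable c)
  also have "\<dots> \<le> (\<Prod>i<n. exp (D * (c i)\<^sup>2))"
    by (intro prod_mono conjI mgf_le c integral_nonneg) auto
  also have "\<dots> = exp (D * (\<Sum>i<n. (c i)\<^sup>2))"
    by (simp add: exp_sum sum_distrib_left)
  also have "\<dots> \<le> exp D"
    using mult_left_mono[OF assms D_nonneg] by simp
  finally show "expectation (\<lambda>\<omega>. exp (\<Sum>i<n. c i * X i \<omega>)) \<le> exp D" .
qed

lemma excess_linear_combination:
  assumes "(\<Sum>i<n. (c i)\<^sup>2) \<le> 1" "\<tau> \<ge> 0"
  shows "integrable \<Omega> (\<lambda>\<omega>. excess \<tau> (\<Sum>i<n. c i * X i \<omega>))"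
    and "expectation (\<lambda>\<omega>. excess \<tau> (\<Sum>i<n. c i * X i \<omega>)) \<le> 4 * exp D * exp (-\<tau>)"
proof -
  let ?Z = "\<lambda>\<omega>. \<Sum>i<n. c i * X i \<omega>"
  have [measurable]: "X i \<in> borel_measurable \<Omega>" if "i < n" for i
    using indep that by (auto simp: indep_vars_def)
  have Z: "?Z \<in> borel_measurable \<Omega>" by (intro borel_measurable_sum) auto
  note pos = mgf_linear_combination[OF assms(1)]
  have neg: "integrable \<Omega> (\<lambda>\<omega>. exp (- ?Z \<omega>))" "expectation (\<lambda>\<omega>. exp (- ?Z \<omega>)) \<le> exp D"
    using mgf_linear_combination[of "\<lambda>i. - c i"] assms(1) by (simp_all add: sum_negf)
  have dom: "integrable \<Omega> (\<lambda>\<omega>. 2 * exp (-\<tau>) * (exp (?Z \<omega>) + exp (- ?Z \<omega>)))"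
    using pos(1) neg(1) by auto
  show int: "integrable \<Omega> (\<lambda>\<omega>. excess \<tau> (?Z \<omega>))"
  proof (rule Bochner_Integration.integrable_bound[OF dom])
    show "(\<lambda>\<omega>. excess \<tau> (?Z \<omega>)) \<in> borel_measurable \<Omega>"
      unfolding excess_def using Z by measurable
    show "AE \<omega> in \<Omega>. norm (excess \<tau> (?Z \<omega>)) \<le> norm (2 * exp (-\<tau>) * (exp (?Z \<omega>) + exp (- ?Z \<omega>)))"
      using excess_le_exp[OF assms(2)] by (intro AE_I2) (simp add: excess_nonneg)
  qed
  have "expectation (\<lambda>\<omega>. excess \<tau> (?Z \<omega>)) \<le> expectation (\<lambda>\<omega>. 2 * exp (-\<tau>) * (exp (?Z \<omega>) + exp (- ?Z \<omega>)))"
    by (intro integral_mono int dom excess_le_exp assms(2))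
  also have "\<dots> = 2 * exp (-\<tau>) * (expectation (\<lambda>\<omega>. exp (?Z \<omega>)) + expectation (\<lambda>\<omega>. exp (- ?Z \<omega>)))"
    using pos(1) neg(1) by simp
  also have "\<dots> \<le> 2 * exp (-\<tau>) * (exp D + exp D)"
    by (intro mult_left_mono add_mono pos(2) neg(2)) auto
  finally show "expectation (\<lambda>\<omega>. excess \<tau> (?Z \<omega>)) \<le> 4 * exp D * exp (-\<tau>)" by (simp add: mult_ac)
qed

lemma block_sum_noise:
  "block_sum (noise \<omega>) j k = (\<Sum>i<n. indicat_real {k * 2^j..<k * 2^j + 2^j} i * X i \<omega>)"
proof -
  have "block_sum (noise \<omega>) j k = (\<Sum>i\<in>{k * 2^j..<k * 2^j + 2^j} \<inter> {..<n}. X i \<omega>)"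
    unfolding block_sum_def noise_def by (simp add: sum.If_cases Int_def lessThan_def)
  also have "\<dots> = (\<Sum>i<n. if i \<in> {k * 2^j..<k * 2^j + 2^j} then X i \<omega> else 0)"
    by (simp add: sum.inter_restrict Int_commute)
  also have "\<dots> = (\<Sum>i<n. indicat_real {k * 2^j..<k * 2^j + 2^j} i * X i \<omega>)"
    by (intro sum.cong) (auto simp: indicator_def)
  finally show ?thesis .
qed

text \<open>An inequality because a block may reach beyond \<open>n\<close>.\<close>

lemma sum_indicator_block: "(\<Sum>i<n. indicat_real {k * 2^j..<k * 2^j + 2^j} i) \<le> 2^j"
proof -
  have "(\<Sum>i<n. indicat_real {k * 2^j..<k * 2^j + 2^j} i) = real (card ({..<n} \<inter> {k * 2^j..<k * 2^j + 2^j}))"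
    by (simp add: indicator_def sum.If_cases Int_def)
  also have "\<dots> \<le> real (card {k * 2^j..<k * 2^j + 2^j})"
    by (intro of_nat_mono card_mono) auto
  finally show ?thesis by simp
qed

lemma excess_block_coeff:
  assumes "\<tau> \<ge> 0"
  shows "integrable \<Omega> (\<lambda>\<omega>. excess \<tau> (block_coeff (noise \<omega>) j k))"
    and "expectation (\<lambda>\<omega>. excess \<tau> (block_coeff (noise \<omega>) j k)) \<le> 4 * exp D * exp (-\<tau>)"
proof -
  define c where "c i = indicat_real {k * 2^j..<k * 2^j + 2^j} i / sqrt (2^j)" for i
  have eq: "block_coeff (noise \<omega>) j k = (\<Sum>i<n. c i * X i \<omega>)" for \<omega>
    unfolding block_coeff_def block_sum_noise c_def sum_divide_distrib
    by (intro sum.cong) auto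
  have "(\<Sum>i<n. (c i)\<^sup>2) = (\<Sum>i<n. indicat_real {k * 2^j..<k * 2^j + 2^j} i) / 2^j"
    unfolding c_def sum_divide_distrib by (intro sum.cong) (auto simp: power_divide indicator_def)
  also have "\<dots> \<le> 1" using sum_indicator_block[of k j] by simp
  finally have c: "(\<Sum>i<n. (c i)\<^sup>2) \<le> 1" .
  show "integrable \<Omega> (\<lambda>\<omega>. excess \<tau> (block_coeff (noise \<omega>) j k))"
    and "expectation (\<lambda>\<omega>. excess \<tau> (block_coeff (noise \<omega>) j k)) \<le> 4 * exp D * exp (-\<tau>)"
    unfolding eq by (rule excess_linear_combination[OF c assms])+
qed

lemma excess_haar_coeff:
  assumes "\<tau> \<ge> 0"
  shows "integrable \<Omega> (\<lambda>\<omega>. excess \<tau> (haar_coeff (noise \<omega>) j k))"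
    and "expectation (\<lambda>\<omega>. excess \<tau> (haar_coeff (noise \<omega>) j k)) \<le> 4 * exp D * exp (-\<tau>)"
proof -
  define I where "I k i = indicat_real {k * 2^j..<k * 2^j + 2^j} i" for k i :: nat
  define c where "c i = (I (2 * k) i - I (2 * k + 1) i) / sqrt (2 ^ Suc j)" for i
  have eq: "haar_coeff (noise \<omega>) j k = (\<Sum>i<n. c i * X i \<omega>)" for \<omega>
    unfolding haar_coeff_def block_sum_noise c_def I_def sum_subtractf[symmetric] sum_divide_distrib
    by (intro sum.cong) (auto simp: algebra_simps)
  have "(c i)\<^sup>2 \<le> (I (2 * k) i + I (2 * k + 1) i) / 2 ^ Suc j" for i
  proof -
    have "(I (2 * k) i - I (2 * k + 1) i)\<^sup>2 \<le> I (2 * k) i + I (2 * k + 1) i"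
      unfolding I_def by (auto simp: indicator_def)
    then show ?thesis unfolding c_def power_divide by (simp add: divide_right_mono)
  qed
  then have "(\<Sum>i<n. (c i)\<^sup>2) \<le> (\<Sum>i<n. (I (2 * k) i + I (2 * k + 1) i) / 2 ^ Suc j)"
    by (rule sum_mono)
  also have "\<dots> = ((\<Sum>i<n. I (2 * k) i) + (\<Sum>i<n. I (2 * k + 1) i)) / 2 ^ Suc j"
    by (simp only: sum.distrib flip: sum_divide_distrib)
  also have "\<dots> \<le> (2 ^ j + 2 ^ j) / 2 ^ Suc j"
    unfolding I_def by (intro divide_right_mono add_mono sum_indicator_block) auto
  finally have c: "(\<Sum>i<n. (c i)\<^sup>2) \<le> 1" by simp
  show "integrable \<Omega> (\<lambda>\<omega>. excess \<tau> (haar_coeff (noise \<omega>) j k))"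
    and "expectation (\<lambda>\<omega>. excess \<tau> (haar_coeff (noise \<omega>) j k)) \<le> 4 * exp D * exp (-\<tau>)"
    unfolding eq by (rule excess_linear_combination[OF c assms])+
qed

lemma haar_energy_noise:
  assumes "m \<le> J"
  shows "integrable \<Omega> (\<lambda>\<omega>. haar_energy J m (noise \<omega>))"
    and "expectation (\<lambda>\<omega>. haar_energy J m (noise \<omega>)) \<le> 24 * exp D * 2^(J - m)"
proof -
  note int = excess_block_coeff(1) excess_haar_coeff(1)
  show "integrable \<Omega> (\<lambda>\<omega>. haar_energy J m (noise \<omega>))"
    unfolding haar_energy_def
    by (intro Bochner_Integration.integrable_add Bochner_Integration.integrable_sum int) auto
  have "expectation (\<lambda>\<omega>. haar_energy J m (noise \<omega>)) =
     (\<Sum>k<2^(J - m). expectation (\<lambda>\<omega>. excess 0 (block_coeff (noise \<omega>) m k)))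
     + (\<Sum>j<m. \<Sum>k<2^(J - Suc j). expectation (\<lambda>\<omega>. excess (real (m - j)) (haar_coeff (noise \<omega>) j k)))"
    unfolding haar_energy_def
    by (simp only: Bochner_Integration.integral_add Bochner_Integration.integral_sum
        Bochner_Integration.integrable_sum int of_nat_0_le_iff order_refl)
  also have "\<dots> \<le> (\<Sum>k<(2::nat)^(J - m). 4 * exp D * exp (-0))
     + (\<Sum>j<m. \<Sum>k<(2::nat)^(J - Suc j). 4 * exp D * exp (- real (m - j)))"
    by (intro add_mono sum_mono excess_block_coeff excess_haar_coeff) auto
  also have "\<dots> = 4 * exp D * (2^(J - m) + (\<Sum>j<m. 2^(J - Suc j) * exp (- real (m - j))))"
    by (simp add: sum_distrib_left algebra_simps)
  \<comment> \<open>All finer levels together weigh at most five times the coarsest blocks; 24 is 4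
    times 1 + 5.\<close>
  also have "\<dots> \<le> 4 * exp D * (2^(J - m) + 5 * 2^(J - m))"
    by (intro mult_left_mono add_left_mono sum_exp_threshold_le assms) auto
  finally show "expectation (\<lambda>\<omega>. haar_energy J m (noise \<omega>)) \<le> 24 * exp D * 2^(J - m)" by simp
qed

lemma prob_haar_energy_le:
  assumes "m \<le> J" "\<delta> > 0"
  shows "prob {\<omega>\<in>space \<Omega>. haar_energy J m (noise \<omega>) \<le> 24 * exp D / \<delta> * 2^(J - m)} \<ge> 1 - \<delta>"
proof -
  let ?R = "\<lambda>\<omega>. haar_energy J m (noise \<omega>)"
  define c where "c = 24 * exp D / \<delta> * 2^(J - m)"
  have c: "c > 0" using assms(2) by (simp add: c_def)
  note int = haar_energy_noise[OF assms(1)]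
  then have [measurable]: "?R \<in> borel_measurable \<Omega>" by auto
  have "prob {\<omega>\<in>space \<Omega>. ?R \<omega> \<ge> c} \<le> expectation ?R / c"
    using int(1) c by (intro integral_Markov_inequality_measure[where A = "{}"]) (auto simp: haar_energy_nonneg)
  also have "\<dots> \<le> (24 * exp D * 2^(J - m)) / c" using int(2) c by (intro divide_right_mono) auto
  also have "\<dots> = \<delta>" using assms(2) by (simp add: c_def)
  finally have "prob {\<omega>\<in>space \<Omega>. ?R \<omega> \<ge> c} \<le> \<delta>" .
  moreover have "prob (space \<Omega> - {\<omega>\<in>space \<Omega>. ?R \<omega> \<ge> c}) = 1 - prob {\<omega>\<in>space \<Omega>. ?R \<omega> \<ge> c}"
    by (rule prob_compl) measurable
  moreover have "prob (space \<Omega> - {\<omega>\<in>space \<Omega>. ?R \<omega> \<ge> c}) \<le> prob {\<omega>\<in>space \<Omega>. ?R \<omega> \<le> c}"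
    by (rule finite_measure_mono) auto
  ultimately show ?thesis by (simp add: c_def)
qed

end

section \<open>Rate of convergence\<close>

text \<open>\<open>m\<close> is the largest level whose thresholds can be paid for by
  \<open>lam\<close> times the variation; the factor 2 anticipates the reflection. Level 0 is always
  admissible, having no thresholds, and the summand 1 covers \<open>m = J\<close>.\<close>

lemma level_exists:
  assumes "n \<ge> 1" "lam > 0"
  obtains J m where "n \<le> 2^J" "2^J \<le> 2 * n" "m \<le> J"
    "m = 0 \<or> 2 * level_const * sqrt (2^m) \<le> lam"
    "2^(J - m) \<le> 1 + 16 * level_const\<^sup>2 * real n / lam\<^sup>2"
proof -
  let ?A = level_const
  have "n \<le> 2 ^ n" using less_exp[of n] by simp
  then obtain J where J: "n \<le> 2^J" "\<And>i. i < J \<Longrightarrow> \<not> n \<le> 2^i"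
    using exists_least_iff[of "\<lambda>J. n \<le> 2^J"] by blast
  have J2: "2^J \<le> 2 * n"
  proof (cases J)
    case 0
    then show ?thesis using assms(1) by simp
  next
    case (Suc i)
    then show ?thesis using J(2)[of i] by simp
  qed
  define S where "S = {m. m \<le> J \<and> (m = 0 \<or> 2 * ?A * sqrt (2^m) \<le> lam)}"
  define m where "m = Max S"
  have S: "finite S" "S \<noteq> {}" by (auto simp: S_def)
  then have m: "m \<in> S" unfolding m_def by (rule Max_in)
  have "2^(J - m) \<le> 1 + 16 * ?A\<^sup>2 * real n / lam\<^sup>2"
  proof (cases "m = J")
    case False
    \<comment> \<open>By maximality the next level is too expensive, so \<open>2^m\<close> is at
      least of order \<open>lam\<^sup>2\<close>. The 16 is the 8 below times the 2 in
      \<open>2^J \<le> 2 * n\<close>.\<close>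
    have "Suc m \<notin> S" using Max_ge[OF S(1), of "Suc m"] by (auto simp: m_def)
    then have "lam < 2 * ?A * sqrt (2^Suc m)" using m False by (auto simp: S_def)
    then have "lam\<^sup>2 \<le> (2 * ?A * sqrt (2^Suc m))\<^sup>2" using assms(2) by (intro power_mono) auto
    also have "\<dots> = 8 * ?A\<^sup>2 * 2^m" by (simp add: power_mult_distrib)
    finally have lam: "lam\<^sup>2 \<le> 8 * ?A\<^sup>2 * 2^m" .
    have "2^(J - m) * (2::real)^m = 2^J" using m by (simp add: S_def flip: power_add)
    also have "\<dots> \<le> 2 * real n" using of_nat_mono[OF J2, where 'a = real] by simp
    finally have *: "2^(J - m) * 2^m * (8 * ?A\<^sup>2) \<le> 2 * real n * (8 * ?A\<^sup>2)" by (rule mult_right_mono) simp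
    have "2^(J - m) * lam\<^sup>2 \<le> 2^(J - m) * (8 * ?A\<^sup>2 * 2^m)" using lam by (rule mult_left_mono) simp
    also have "\<dots> = 2^(J - m) * 2^m * (8 * ?A\<^sup>2)" by simp
    also note *
    also have "2 * real n * (8 * ?A\<^sup>2) = 16 * ?A\<^sup>2 * real n" by simp
    finally have "2^(J - m) * lam\<^sup>2 \<le> 16 * ?A\<^sup>2 * real n" .
    then have "2^(J - m) \<le> 16 * ?A\<^sup>2 * real n / lam\<^sup>2" using assms(2) by (subst pos_le_divide_eq) auto
    then show ?thesis by simp
  qed simp
  with that[of J m] J(1) J2 m show ?thesis by (auto simp: S_def)
qed

text \<open>Reflecting the vector at its end extends it to a power of two without adding variation.\<close>

lemma inner_product_le_haar_energy_reflect:
  assumes "n \<ge> 1" "n \<le> 2^J" "2^J \<le> 2 * n" "m \<le> J" "lam \<ge> 0"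
    and lam: "m = 0 \<or> 2 * level_const * sqrt (2^m) \<le> lam"
    and e: "\<And>i. i \<ge> n \<Longrightarrow> e i = 0"
  shows "(\<Sum>i<n. e i * v i) \<le> 2 * haar_energy J m e + (\<Sum>i<n. (v i)\<^sup>2) / 4
    + lam * (\<Sum>i<n - 1. \<bar>v (Suc i) - v i\<bar>)"
proof -
  define w where "w i = (if i < n then v i else v (2 * n - 1 - i))" for i
  \<comment> \<open>Truncated subtraction gives \<open>g 0 = 0\<close>, and likewise
    \<open>w (2 * n) = v 0\<close>, so the step past the end of the reflected vector adds
    nothing.\<close>
  define g where "g i = \<bar>v i - v (i - 1)\<bar>" for i
  define TV where "TV = (\<Sum>i<n - 1. \<bar>v (Suc i) - v i\<bar>)"
  obtain n' where n': "n = Suc n'" using assms(1) by (cases n) auto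
  have double: "(\<Sum>i<2 * n. f i) = (\<Sum>i<n. f i) + (\<Sum>i<n. f (n + i))" for f :: "nat \<Rightarrow> real"
    using sum.nat_group[of f n 2] sum.lessThan_Suc[of "\<lambda>m. sum f {m * n..<m * n + n}" 1]
      sum.shift_bounds_nat_ivl[of f 0 n n]
    by (simp add: numeral_2_eq_2 lessThan_atLeast0 add.commute mult.commute)
  have "(\<Sum>i<2^J. e i * w i) = (\<Sum>i<n. e i * w i)"
    using assms(2) e by (intro sum.mono_neutral_right) auto
  then have inner: "(\<Sum>i<2^J. e i * w i) = (\<Sum>i<n. e i * v i)" by (simp add: w_def)
  have "(\<Sum>i<2^J. (w i)\<^sup>2) \<le> (\<Sum>i<2 * n. (w i)\<^sup>2)"
    using assms(3) by (intro sum_mono2) auto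
  also have "\<dots> = (\<Sum>i<n. (v i)\<^sup>2) + (\<Sum>i<n. (v (n - Suc i))\<^sup>2)"
    unfolding double by (simp add: w_def)
  also have "(\<Sum>i<n. (v (n - Suc i))\<^sup>2) = (\<Sum>i<n. (v i)\<^sup>2)"
    by (rule sum.nat_diff_reindex)
  finally have norm: "(\<Sum>i<2^J. (w i)\<^sup>2) \<le> 2 * (\<Sum>i<n. (v i)\<^sup>2)" by simp
  have "(\<Sum>i<2^J. \<bar>w (Suc i) - w i\<bar>) \<le> (\<Sum>i<2 * n. \<bar>w (Suc i) - w i\<bar>)"
    using assms(3) by (intro sum_mono2) auto
  also have "\<dots> = (\<Sum>i<n. \<bar>w (Suc i) - w i\<bar>) + (\<Sum>i<n. g (n - Suc i))"
    unfolding double by (simp add: w_def g_def abs_minus_commute)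
  also have "(\<Sum>i<n. \<bar>w (Suc i) - w i\<bar>) = TV"
    unfolding TV_def by (simp add: n' w_def)
  also have "(\<Sum>i<n. g (n - Suc i)) = (\<Sum>i<n. g i)" by (rule sum.nat_diff_reindex)
  also have "\<dots> = TV"
    unfolding TV_def n' sum.lessThan_Suc_shift by (simp add: g_def)
  finally have tv: "(\<Sum>i<2^J. \<bar>w (Suc i) - w i\<bar>) \<le> 2 * TV" by simp
  have "TV \<ge> 0" unfolding TV_def by (rule sum_nonneg) simp
  have "(\<Sum>j<m. real (m - j) * sqrt (2^j)) * (\<Sum>i<2^J. \<bar>w (Suc i) - w i\<bar>)
      \<le> (\<Sum>j<m. real (m - j) * sqrt (2^j)) * (2 * TV)"
    using tv by (intro mult_left_mono sum_nonneg) auto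
  also have "\<dots> \<le> lam * TV"
  proof (cases "m = 0")
    case False
    with lam sum_threshold_le[of m] have "2 * (\<Sum>j<m. real (m - j) * sqrt (2^j)) \<le> lam" by simp
    from mult_right_mono[OF this \<open>TV \<ge> 0\<close>] show ?thesis by (simp add: mult_ac)
  qed (use \<open>TV \<ge> 0\<close> assms(5) in simp)
  finally show ?thesis
    using inner_product_le_haar_energy[OF assms(4), of e w] norm unfolding inner TV_def[symmetric] by simp
qed

section \<open>Deterministic error bound and rates\<close>

lemma fused_penalty_conv_path_length:
  assumes "length vs = n"
  shows "fused_penalty n vs \<theta> = path_length \<theta> vs"
proof (cases n)
  case (Suc k)
  have "fused_penalty n vs \<theta> = (\<Sum>i = 0..<k. \<bar>diff_1d (perm_vec vs \<theta>) (Suc i)\<bar>)"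
    unfolding Suc One_nat_def by (rule sum.shift_bounds_Suc_ivl)
  then show ?thesis
    using assms Suc by (simp add: path_length_conv_sum diff_1d_def perm_vec_def atLeast0LessThan)
qed (use assms in simp)

text \<open>The noise bound carries the variation of \<delta> with exactly the factor
  \<open>lam\<close>, so after the triangle inequality the penalty of the estimator cancels. What
  remains is twice the penalty of \<open>\<theta>0\<close>, itself at most
  \<open>2 * t\<close>.\<close>

lemma dfs_fused_lasso_error:
  assumes n: "n \<ge> 1" and G: "connected_graph {1..n} E" and vs: "dfs_ordering {1..n} E vs"
    and \<theta>0: "\<theta>0 \<in> BV n E t" and y: "\<And>i. i \<in> {1..n} \<Longrightarrow> y i = \<theta>0 i + \<epsilon> i" and lam: "lam > 0"
    and level: "n \<le> 2^J" "2^J \<le> 2 * n" "m \<le> J" "m = 0 \<or> 2 * level_const * sqrt (2^m) \<le> lam"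
  shows "(\<Sum>i\<in>{1..n}. (dfs_fused_lasso n vs lam y i - \<theta>0 i)\<^sup>2)
    \<le> 3 * haar_energy J m (\<lambda>i. if i < n then \<epsilon> (vs ! i) else 0) + 6 * lam * t"
proof -
  let ?\<theta> = "dfs_fused_lasso n vs lam y" and ?P = "fused_penalty n vs"
  define \<delta> where "\<delta> i = ?\<theta> i - \<theta>0 i" for i
  define e where "e i = (if i < n then \<epsilon> (vs ! i) else 0)" for i
  define Q where "Q = (\<Sum>i\<in>{1..n}. (\<delta> i)\<^sup>2)"
  have dist: "distinct vs" and set: "set vs = {1..n}" using dfs_ordering_permutation[OF G vs] by auto
  then have len: "length vs = n" using distinct_card by fastforce
  have bij: "bij_betw ((!) vs) {..<n} {1..n}" using bij_betw_nth[OF dist] set len by auto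
  have Q: "Q = (\<Sum>i<n. (\<delta> (vs ! i))\<^sup>2)"
    unfolding Q_def by (rule sum.reindex_bij_betw[OF bij, symmetric])
  have "finite E"
    using G finite_subset[of E "Pow {1..n}"] by (auto simp: connected_graph_def simple_graph_def)
  have \<theta>0': "\<theta>0 \<in> Rn n" "graph_tv E \<theta>0 \<le> t" using \<theta>0 by (auto simp: BV_def)
  have P0: "?P \<theta>0 \<le> 2 * t"
    unfolding fused_penalty_conv_path_length[OF len]
    using dfs_ordering_path_length[OF \<open>finite E\<close> vs, of \<theta>0] \<theta>0'(2) by simp
  have "0 \<le> ?P \<theta>0" by (rule sum_nonneg) simp
  then have "0 \<le> 2 * t" using P0 by (rule order.trans)
  then have lt: "0 \<le> lam * t" using lam by simp
  have "(\<Sum>i\<in>{1..n}. \<epsilon> i * \<delta> i) = (\<Sum>i<n. \<epsilon> (vs ! i) * \<delta> (vs ! i))"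
    by (rule sum.reindex_bij_betw[OF bij, symmetric])
  also have "\<dots> = (\<Sum>i<n. e i * \<delta> (vs ! i))" by (simp add: e_def)
  also have "\<dots> \<le> 2 * haar_energy J m e + Q / 4 + lam * (\<Sum>i<n - 1. \<bar>\<delta> (vs ! Suc i) - \<delta> (vs ! i)\<bar>)"
    unfolding Q using lam
    by (intro inner_product_le_haar_energy_reflect n level) (auto simp: e_def)
  also have "(\<Sum>i<n - 1. \<bar>\<delta> (vs ! Suc i) - \<delta> (vs ! i)\<bar>) = ?P \<delta>"
    unfolding fused_penalty_conv_path_length[OF len] path_length_conv_sum len ..
  finally have noise: "(\<Sum>i\<in>{1..n}. \<epsilon> i * \<delta> i) \<le> 2 * haar_energy J m e + Q / 4 + lam * ?P \<delta>" .
  have "(\<Sum>i\<in>{1..n}. (y i - ?\<theta> i) * (\<theta>0 i - ?\<theta> i)) = Q - (\<Sum>i\<in>{1..n}. \<epsilon> i * \<delta> i)"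
    unfolding Q_def sum_subtractf[symmetric]
    by (intro sum.cong) (auto simp: y \<delta>_def power2_eq_square algebra_simps)
  then have basic: "Q - (\<Sum>i\<in>{1..n}. \<epsilon> i * \<delta> i) \<le> lam * (?P \<theta>0 - ?P ?\<theta>)"
    using dfs_fused_lasso_variational_ineq[of lam \<theta>0 n y vs] lam \<theta>0'(1) by simp
  have "?P \<delta> \<le> ?P ?\<theta> + ?P \<theta>0" unfolding \<delta>_def by (rule fused_penalty_triangle)
  then have "lam * ?P \<delta> \<le> lam * (?P ?\<theta> + ?P \<theta>0)" using lam by (intro mult_left_mono) auto
  moreover have "lam * ?P \<theta>0 \<le> lam * (2 * t)" using P0 lam by (intro mult_left_mono) auto
  ultimately have "3 / 4 * Q \<le> 2 * haar_energy J m e + 4 * (lam * t)"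
    using noise basic unfolding distrib_left right_diff_distrib by linarith
  \<comment> \<open>The factors 8/3 and 16/3 are rounded up, which requires both terms to be
    nonnegative.\<close>
  then have "Q \<le> 3 * haar_energy J m e + 6 * (lam * t)"
    using haar_energy_nonneg[of J m e] lt by linarith
  then show ?thesis unfolding Q_def \<delta>_def e_def by simp
qed

text \<open>\<open>r\<close> is \<open>n\<close> times the target rate. The lower bound on
  \<open>t\<close> enters only in the last claim, by which the summand 1 in the number of coarsest
  blocks is absorbed.\<close>

lemma rate_bounds:
  fixes n t lam c1 c2 c3 :: real
  assumes "n \<ge> 1" "t > 0" "lam > 0"
    and up: "lam \<le> c2 * (t powr (-1/3) * n powr (1/3))"
    and lo: "inverse lam \<le> c1 * inverse (t powr (-1/3) * n powr (1/3))"
    and t: "inverse t \<le> c3 * sqrt n" and "c3 > 0"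
  defines "r \<equiv> n * (t powr (2/3) * n powr (-2/3))"
  shows "lam * t \<le> c2 * r" "n / lam\<^sup>2 \<le> c1\<^sup>2 * r" "1 \<le> c3 powr (2/3) * r"
proof -
  have r: "r = t powr (2/3) * n powr (1/3)"
    using powr_add[of n 1 "-2/3"] assms(1) by (simp add: r_def)
  have "lam * t \<le> c2 * (t powr (-1/3) * n powr (1/3)) * t" using up assms(2) by (intro mult_right_mono) auto
  also have "\<dots> = c2 * r" using powr_add[of t "-1/3" 1] assms(2) by (simp add: r)
  finally show "lam * t \<le> c2 * r" .
  have "(inverse lam)\<^sup>2 \<le> (c1 * inverse (t powr (-1/3) * n powr (1/3)))\<^sup>2"
    using lo assms(3) by (intro power_mono) auto
  also have "\<dots> = c1\<^sup>2 * (t powr (2/3) * n powr (-2/3))"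
    using assms(1,2) by (simp add: power_mult_distrib powr_powr power_inverse flip: powr_numeral powr_minus)
  finally have "n * (inverse lam)\<^sup>2 \<le> n * (c1\<^sup>2 * (t powr (2/3) * n powr (-2/3)))"
    using assms(1) by (intro mult_left_mono) auto
  moreover have "n * (inverse lam)\<^sup>2 = n / lam\<^sup>2" using assms(3) by (simp add: field_simps)
  moreover have "n * (c1\<^sup>2 * (t powr (2/3) * n powr (-2/3))) = c1\<^sup>2 * r" by (simp add: r_def)
  ultimately show "n / lam\<^sup>2 \<le> c1\<^sup>2 * r" by (simp only:)
  have "1 \<le> c3 * sqrt n * t" using t assms(2) by (simp add: field_simps)
  then have "1 powr (2/3) \<le> (c3 * n powr (1/2) * t) powr (2/3)"
    using assms(1) by (intro powr_mono2) (auto simp: powr_half_sqrt)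
  then show "1 \<le> c3 powr (2/3) * r"
    using assms(1,2,7) by (simp add: r powr_mult powr_powr mult_ac)
qed

theorem theorem2:
  fixes \<Omega> :: "nat \<Rightarrow> 'a measure"
    and E :: "nat \<Rightarrow> nat set set"
    and t lam :: "nat \<Rightarrow> real"
    and vs :: "nat \<Rightarrow> nat list"
    and \<theta>0 :: "nat \<Rightarrow> nat \<Rightarrow> real"
    and \<epsilon> y :: "nat \<Rightarrow> nat \<Rightarrow> 'a \<Rightarrow> real"
    and M \<sigma> :: real
  assumes "M > 0" and "\<sigma> > 0"
    and "\<And>n. n \<ge> 1 \<Longrightarrow> prob_space (\<Omega> n)"
    and "\<And>n. n \<ge> 1 \<Longrightarrow> iid_vars (\<Omega> n) {1..n} (\<epsilon> n)"
    and "\<And>n i. n \<ge> 1 \<Longrightarrow> i \<in> {1..n} \<Longrightarrow> sub_gaussian (\<Omega> n) M \<sigma> (\<epsilon> n i)"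
    and "\<And>n i \<omega>. n \<ge> 1 \<Longrightarrow> i \<in> {1..n} \<Longrightarrow> \<omega> \<in> space (\<Omega> n) \<Longrightarrow> y n i \<omega> = \<theta>0 n i + \<epsilon> n i \<omega>"
    and "\<And>n. n \<ge> 1 \<Longrightarrow> connected_graph {1..n} (E n)"
    and "\<And>n. n \<ge> 1 \<Longrightarrow> t n > 0"
    and "(\<lambda>n. inverse (t n)) \<in> O(\<lambda>n. sqrt (real n))"
    and "\<And>n. n \<ge> 1 \<Longrightarrow> \<theta>0 n \<in> BV n (E n) (t n)"
    and "\<And>n. n \<ge> 1 \<Longrightarrow> dfs_ordering {1..n} (E n) (vs n)"
    and "\<And>n. n \<ge> 1 \<Longrightarrow> lam n > 0"
    and "same_order lam (\<lambda>n. t n powr (-1/3) * real n powr (1/3))"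
  shows "bigo_prob \<Omega>
      (\<lambda>n \<omega>. sq_norm_n n (\<lambda>i. dfs_fused_lasso n (vs n) (lam n) (\<lambda>j. y n j \<omega>) i - \<theta>0 n i))
      (\<lambda>n. t n powr (2/3) * real n powr (-2/3))"
  unfolding bigo_prob_def
proof (intro allI impI)
  fix \<delta> :: real assume \<delta>: "\<delta> > 0"
  let ?b = "\<lambda>n. t n powr (-1/3) * real n powr (1/3)" and ?r = "\<lambda>n. t n powr (2/3) * real n powr (-2/3)"
  define D where "D = 2 * exp_moment_bound M \<sigma>"
  have D: "D \<ge> 0" using assms(1) by (simp add: D_def exp_moment_bound_def)
  obtain c2 where c2: "\<forall>\<^sub>F n in sequentially. norm (lam n) \<le> c2 * norm (?b n)"
    using assms(13) unfolding same_order_def by (auto elim: landau_o.bigE)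
  obtain c1 where c1: "\<forall>\<^sub>F n in sequentially. norm (inverse (lam n)) \<le> c1 * norm (inverse (?b n))"
    using assms(13) unfolding same_order_def by (auto elim: landau_o.bigE)
  obtain c3 where c3: "c3 > 0" "\<forall>\<^sub>F n in sequentially. norm (inverse (t n)) \<le> c3 * norm (sqrt (real n))"
    using assms(9) by (auto elim: landau_o.bigE)
  \<comment> \<open>The Markov constant for which the energy bound fails with probability at most
    \<delta>.\<close>
  define K where "K = 24 * exp D / \<delta>"
  have K: "K \<ge> 0" using \<delta> by (simp add: K_def)
  define C where "C = 3 * K * (c3 powr (2/3) + 16 * level_const\<^sup>2 * c1\<^sup>2) + 6 * c2"
  show "\<exists>C. \<forall>\<^sub>F n in sequentially. measure (\<Omega> n) {\<omega>\<in>space (\<Omega> n).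
      \<bar>sq_norm_n n (\<lambda>i. dfs_fused_lasso n (vs n) (lam n) (\<lambda>j. y n j \<omega>) i - \<theta>0 n i)\<bar> \<le> C * \<bar>?r n\<bar>} \<ge> 1 - \<delta>"
  proof (intro exI[of _ C], use c1 c2 c3(2) eventually_ge_at_top[of 1] in eventually_elim)
    case (elim n)
    then have n: "n \<ge> 1" by simp
    interpret prob_space "\<Omega> n" by (rule assms(3)[OF n])
    define R where "R = real n * ?r n"
    have rates: "lam n * t n \<le> c2 * R" "real n / (lam n)\<^sup>2 \<le> c1\<^sup>2 * R" "1 \<le> c3 powr (2/3) * R"
      using rate_bounds[of "real n" "t n" "lam n" c2 c1 c3] elim n c3(1) assms(8)[OF n] assms(12)[OF n]
      unfolding R_def by (simp_all add: abs_mult)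
    obtain J m where level: "n \<le> 2^J" "2^J \<le> 2 * n" "m \<le> J"
        "m = 0 \<or> 2 * level_const * sqrt (2^m) \<le> lam n"
        "2^(J - m) \<le> 1 + 16 * level_const\<^sup>2 * real n / (lam n)\<^sup>2"
      using level_exists[OF n assms(12)[OF n]] by blast
    \<comment> \<open>The errors are listed in the order of the search, where the estimator is a
      fused lasso on a path.\<close>
    define X where "X i = \<epsilon> n (vs n ! i)" for i
    have dist: "distinct (vs n)" and set: "set (vs n) = {1..n}"
      using dfs_ordering_permutation[OF assms(7)[OF n] assms(11)[OF n]] by auto
    then have len: "length (vs n) = n" using distinct_card by fastforce
    have bij: "bij_betw ((!) (vs n)) {..<n} {1..n}" using bij_betw_nth[OF dist] set len by auto
    have vs_in: "vs n ! i \<in> {1..n}" if "i < n" for i using bij that by (auto simp: bij_betw_def)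
    have indep: "indep_vars (\<lambda>_. borel) X {..<n}"
      using assms(4)[OF n] bij indep_vars_reindex[of "(!) (vs n)" "{..<n}" "\<lambda>_. borel" "\<epsilon> n"]
      unfolding iid_vars_def X_def by (auto simp: bij_betw_def)
    note mgf = sub_gaussian_mgf[OF assms(3)[OF n] assms(1,2) assms(5)[OF n vs_in]]
    interpret sub_gaussian_noise "\<Omega> n" n X D
    proof
      show "integrable (\<Omega> n) (\<lambda>\<omega>. exp (a * X i \<omega>))"
        and "expectation (\<lambda>\<omega>. exp (a * X i \<omega>)) \<le> exp (D * a\<^sup>2)" if "i < n" "\<bar>a\<bar> \<le> 1" for i a
        unfolding X_def D_def by (rule mgf[OF that])+
    qed (use indep D in auto)
    let ?X = "\<lambda>\<omega>. sq_norm_n n (\<lambda>i. dfs_fused_lasso n (vs n) (lam n) (\<lambda>j. y n j \<omega>) i - \<theta>0 n i)"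
    have y_meas: "(\<lambda>\<omega>. y n i \<omega>) \<in> borel_measurable (\<Omega> n)" if "i \<in> {1..n}" for i
    proof -
      have "\<epsilon> n i \<in> borel_measurable (\<Omega> n)" using assms(5)[OF n that] by (auto simp: sub_gaussian_def)
      then have "(\<lambda>\<omega>. \<theta>0 n i + \<epsilon> n i \<omega>) \<in> borel_measurable (\<Omega> n)" by simp
      then show ?thesis
        using measurable_cong[of "\<Omega> n" "y n i" "\<lambda>\<omega>. \<theta>0 n i + \<epsilon> n i \<omega>" borel, OF assms(6)[OF n that]]
        by simp
    qed
    have [measurable]: "?X \<in> borel_measurable (\<Omega> n)"
      unfolding sq_norm_n_def
      by (intro borel_measurable_divide borel_measurable_sum borel_measurable_power borel_measurable_diff
          measurable_dfs_fused_lasso y_meas) (use assms(12)[OF n] in auto)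
    have bound: "\<bar>?X \<omega>\<bar> \<le> C * \<bar>?r n\<bar>"
      if \<omega>: "\<omega> \<in> space (\<Omega> n)" and good: "haar_energy J m (noise \<omega>) \<le> K * 2^(J - m)" for \<omega>
    proof -
      let ?Q = "\<Sum>i\<in>{1..n}. (dfs_fused_lasso n (vs n) (lam n) (\<lambda>j. y n j \<omega>) i - \<theta>0 n i)\<^sup>2"
      have "noise \<omega> = (\<lambda>i. if i < n then \<epsilon> n (vs n ! i) \<omega> else 0)"
        by (rule ext) (simp add: noise_def, simp add: X_def)
      moreover have "?Q \<le> 3 * haar_energy J m (\<lambda>i. if i < n then \<epsilon> n (vs n ! i) \<omega> else 0) + 6 * lam n * t n"
        by (rule dfs_fused_lasso_error[OF n assms(7)[OF n] assms(11)[OF n] assms(10)[OF n] _ assms(12)[OF n] level(1-4)])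
          (rule assms(6)[OF n _ \<omega>])
      ultimately have "?Q \<le> 3 * haar_energy J m (noise \<omega>) + 6 * lam n * t n" by simp
      also have "\<dots> \<le> 3 * (K * (1 + 16 * level_const\<^sup>2 * (real n / (lam n)\<^sup>2))) + 6 * (c2 * R)"
        using order.trans[OF good mult_left_mono[OF level(5) K]] rates(1) by simp
      \<comment> \<open>All terms are now multiples of \<open>R\<close>; the levels \<open>J\<close>
        and \<open>m\<close>, which vary with \<open>n\<close>, are gone, so \<open>C\<close> does
        not depend on \<open>n\<close>.\<close>
      also have "\<dots> \<le> 3 * (K * (c3 powr (2/3) * R + 16 * level_const\<^sup>2 * (c1\<^sup>2 * R))) + 6 * (c2 * R)"
        using rates(2,3) K by (intro add_mono mult_left_mono order.refl) auto
      also have "\<dots> = C * R" by (simp add: C_def algebra_simps)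
      finally have "?Q / real n \<le> C * ?r n" using n by (simp add: R_def field_simps)
      moreover have "?Q / real n \<ge> 0" by (intro divide_nonneg_nonneg sum_nonneg) auto
      ultimately show ?thesis by (simp add: sq_norm_n_def abs_mult)
    qed
    have "1 - \<delta> \<le> prob {\<omega>\<in>space (\<Omega> n). haar_energy J m (noise \<omega>) \<le> K * 2^(J - m)}"
      unfolding K_def by (rule prob_haar_energy_le[OF level(3) \<delta>])
    also have "\<dots> \<le> prob {\<omega>\<in>space (\<Omega> n). \<bar>?X \<omega>\<bar> \<le> C * \<bar>?r n\<bar>}"
      using bound by (intro finite_measure_mono) auto
    finally show ?case .
  qed
qed

end
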